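(* Let $d\ge 1$ and $k$ be integers with $k>d/2$, and let $\Omega\subset\mathbb{R}^d$ be a compact set with topological boundary $\partial\Omega$. Assume that $A(\partial\Omega,\phi_{d,k})=\{\phi_{d,k}(|\cdot-y|) : y\in\partial\Omega\}$ is fundamental in $\mathbf{C}(\partial\Omega)$. Let $f\in\mathbf{C}(\Omega)$. Given $\epsilon>0$ there is a finite subset $Y\subset\Omega$ and a set of real coefficients $\{\alpha_y : y\in Y\}$ such that $$\left|f(x)-\sum_{y\in Y}\alpha_y\,\phi_{d,k}(|x-y|)\right|\le\epsilon$$ for all $x\in\Omega$.
   Context: $|\cdot|$ is the Euclidean norm on $\mathbb{R}^d$. For a compact set $K\subset\mathbb{R}^d$, $\mathbf{C}(K)$ is the space of real-valued continuous functions on $K$ with the uniform norm. The polyharmonic spline $\phi_{d,k}:[0,\infty)\to\mathbb{R}$ (for integers $d\ge1$, $k>d/2$) is $\phi_{d,k}(r)=r^{2k-d}$ if $d$ is odd, and $\phi_{d,k}(r)=r^{2k-d}\log r$ if $d$ is even (with value $0$ at $r=0$). A set $A$ is fundamental in a normed vector space $X$ if for every $x\in X$ and $\epsilon>0$ there exist a finite subset $Y\subset A$ and coefficients $a_y$, $y\in Y$, such that $\|x-\sum_{y\in Y}a_y y\|<\epsilon$. In the hypothesis, the functions $\phi_{d,k}(|\cdot-y|)$ are regarded as elements of $\mathbf{C}(\partial\Omega)$ by restriction to $\partial\Omega$. *)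

theory Defs
  imports "HOL-Analysis.Analysis"
begin

text \<open>
  Only meant for \<^term>\<open>r \<ge> (0::real)\<close> and \<^term>\<open>2 * k > (d::nat)\<close>, so that the
  natural-number subtraction in the exponent does not truncate.
\<close>

definition polyharmonic_spline :: "nat \<Rightarrow> nat \<Rightarrow> real \<Rightarrow> real" where
  "polyharmonic_spline d k r =
     (if odd d then r ^ (2 * k - d)
      else if r = 0 then 0 else r ^ (2 * k - d) * ln r)"

text \<open>
  A function on \<open>K\<close> is represented by an extensional function on the ambient type, so that
  restriction to \<open>K\<close> is \<^const>\<open>restrict\<close>; vector space operations are pointwise on \<open>K\<close>.
\<close>

definition cont_funs :: "'a::topological_space set \<Rightarrow> ('a \<Rightarrow> real) set" where
  "cont_funs K = {f \<in> extensional K. continuous_on K f}"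

text \<open>The case distinction is needed since \<^term>\<open>Sup {} :: real\<close> is unspecified.\<close>

definition uniform_norm :: "'a set \<Rightarrow> ('a \<Rightarrow> real) \<Rightarrow> real" where
  "uniform_norm K g = (if K = {} then 0 else (SUP x\<in>K. \<bar>g x\<bar>))"

definition fundamental_in_cont_funs ::
    "'a::topological_space set \<Rightarrow> ('a \<Rightarrow> real) set \<Rightarrow> bool" where
  "fundamental_in_cont_funs K A \<longleftrightarrow>
     A \<subseteq> cont_funs K \<and>
     (\<forall>f\<in>cont_funs K. \<forall>\<epsilon>>0. \<exists>Y a. finite Y \<and> Y \<subseteq> A \<and>
        uniform_norm K (\<lambda>x. f x - (\<Sum>g\<in>Y. a g * g x)) < \<epsilon>)"

definition spline_translates ::
    "(real ^ 'n::finite) set \<Rightarrow> (real \<Rightarrow> real) \<Rightarrow> (real ^ 'n \<Rightarrow> real) set" where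
  "spline_translates K \<phi> = {restrict (\<lambda>x. \<phi> (norm (x - y))) K | y. y \<in> K}"

end

theory Submission
  imports Defs "HOL-Real_Asymp.Real_Asymp"
begin

text \<open>
  Up to a nonzero factor, \<open>\<phi>(|x|)\<close> with \<open>\<phi> = \<phi>\<^bsub>d,k\<^esub>\<close> is a fundamental solution of the iterated
  Laplacian \<open>\<Delta>\<^sup>k\<close> on \<open>\<real>\<^sup>d\<close>. So a smooth function \<open>h\<close> of compact support satisfies
  \<open>h(x) = c \<integral> \<phi>(|x - y|) (\<Delta>\<^sup>k h)(y) dy\<close>, and the Riemann sums of this integral are combinations of
  translates of \<open>\<phi>\<close> with centres in the support of \<open>h\<close>. Hence the translates with centres in
  \<open>\<Omega>\<close> approximate every continuous function that vanishes outside a compact subset of the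
  interior of \<open>\<Omega>\<close> (\<open>approximable_compact_support\<close>). The hypothesis on the boundary reduces the
  theorem to such functions: subtract from \<open>f\<close> a combination of translates that is close to \<open>f\<close> on
  the boundary. The remainder is small near the boundary, so that soft thresholding moves it only a
  little and leaves a function supported in a compact subset of the interior.

  The analysis is arranged so that one-variable calculus and a single integration by parts
  suffice. A radial function \<open>F(|x|\<^sup>2)\<close> has the Laplacian \<open>4 s F''(s) + 2 d F'(s)\<close> at \<open>s = |x|\<^sup>2\<close>, and
  Laplacians are taken only of functions of this kind, with one of two centres. Green's identity
  (\<open>radial_green\<close>) follows from the translation invariance of the Lebesgue measure. As test
  functions \<open>h\<close> serve the bumps \<open>(max 0 (\<rho>\<^sup>2 - |x - z|\<^sup>2)) ^ (2k + 1)\<close>, because mollification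
  writes any continuous function of compact support approximately as an integral of such bumps
  over their centres \<open>z\<close>.

  For the fundamental solution, write \<open>\<phi>(r) = \<Phi>(r\<^sup>2)\<close> and regularise it to \<open>\<Phi>(|x|\<^sup>2 + E)\<close> with \<open>E > 0\<close>.
  An explicit computation gives its \<open>k\<close>-th Laplacian, \<open>C E\<^sup>k (|x|\<^sup>2 + E) powr (-k - d/2)\<close> with
  \<open>C \<noteq> 0\<close> (\<open>regularised_spline_iterates\<close>). For \<open>E = \<epsilon>\<^sup>2\<close> this is \<open>C\<close> times the rescaling
  \<open>\<epsilon>\<^sup>-\<^sup>d K(x/\<epsilon>)\<close> of the positive kernel \<open>K(x) = (1 + |x|\<^sup>2) powr (-k - d/2)\<close>, that is, up to a
  constant factor, an approximate identity. Letting \<open>\<epsilon> \<rightarrow> 0\<close> yields the representation of the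
  bumps (\<open>spline_reproduces_bump\<close>).
\<close>

section \<open>Uniform approximation by combinations of kernel sections\<close>

text \<open>
  The kernel and the set of its parameters are left arbitrary because three kernels occur: the
  spline \<open>\<phi>(|x - y|)\<close>, the bump \<open>(x, z) \<mapsto> h(x - z)\<close>, and evaluation \<open>(x, g) \<mapsto> g(x)\<close> on a family of
  functions \<open>g\<close>.
\<close>

definition approximable :: "'a set \<Rightarrow> 'b set \<Rightarrow> ('a \<Rightarrow> 'b \<Rightarrow> real) \<Rightarrow> ('a \<Rightarrow> real) \<Rightarrow> bool" where
  "approximable K S F g \<longleftrightarrow>
     (\<forall>\<epsilon>>0. \<exists>Y \<alpha>. finite Y \<and> Y \<subseteq> S \<and> (\<forall>x\<in>K. \<bar>g x - (\<Sum>y\<in>Y. \<alpha> y * F x y)\<bar> \<le> \<epsilon>))"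

lemma approximableD:
  assumes "approximable K S F g" "\<epsilon> > 0"
  obtains Y \<alpha> where "finite Y" "Y \<subseteq> S" "\<And>x. x \<in> K \<Longrightarrow> \<bar>g x - (\<Sum>y\<in>Y. \<alpha> y * F x y)\<bar> \<le> \<epsilon>"
proof -
  have "\<exists>Y \<alpha>. finite Y \<and> Y \<subseteq> S \<and> (\<forall>x\<in>K. \<bar>g x - (\<Sum>y\<in>Y. \<alpha> y * F x y)\<bar> \<le> \<epsilon>)"
    using assms by (simp add: approximable_def)
  then show ?thesis using that by metis
qed

lemma approximable_mono:
  assumes "approximable K S F g" "S \<subseteq> T"
  shows "approximable K T F g"
  using assms unfolding approximable_def by (meson order_trans)

lemma approximable_finite_sum:
  assumes "finite Y" "Y \<subseteq> S"
  shows "approximable K S F (\<lambda>x. \<Sum>y\<in>Y. \<alpha> y * F x y)"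
  unfolding approximable_def
proof (intro allI impI)
  fix e :: real assume "e > 0"
  then show "\<exists>Y' \<alpha>'. finite Y' \<and> Y' \<subseteq> S \<and>
      (\<forall>x\<in>K. \<bar>(\<Sum>y\<in>Y. \<alpha> y * F x y) - (\<Sum>y\<in>Y'. \<alpha>' y * F x y)\<bar> \<le> e)"
    using assms by (intro exI[of _ Y] exI[of _ \<alpha>]) auto
qed

lemma approximable_zero: "approximable K S F (\<lambda>x. 0)"
  using approximable_finite_sum[of "{}" S K F] by simp

lemma approximable_add:
  assumes "approximable K S F g" "approximable K S F h"
  shows "approximable K S F (\<lambda>x. g x + h x)"
  unfolding approximable_def
proof (intro allI impI)
  fix e :: real assume "e > 0"
  then have e2: "e/2 > 0" by simp
  obtain Y \<alpha> where Y: "finite Y" "Y \<subseteq> S"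
    and g: "\<And>x. x \<in> K \<Longrightarrow> \<bar>g x - (\<Sum>y\<in>Y. \<alpha> y * F x y)\<bar> \<le> e/2"
    using approximableD[OF assms(1) e2] by metis
  obtain Z \<beta> where Z: "finite Z" "Z \<subseteq> S"
    and h: "\<And>x. x \<in> K \<Longrightarrow> \<bar>h x - (\<Sum>y\<in>Z. \<beta> y * F x y)\<bar> \<le> e/2"
    using approximableD[OF assms(2) e2] by metis
  define \<gamma> where "\<gamma> y = (if y \<in> Y then \<alpha> y else 0) + (if y \<in> Z then \<beta> y else 0)" for y
  have union: "(\<Sum>y\<in>Y \<union> Z. \<gamma> y * F x y) = (\<Sum>y\<in>Y. \<alpha> y * F x y) + (\<Sum>y\<in>Z. \<beta> y * F x y)" for x
  proof -
    have "(\<Sum>y\<in>Y \<union> Z. \<gamma> y * F x y) =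
        (\<Sum>y\<in>Y \<union> Z. if y \<in> Y then \<alpha> y * F x y else 0) + (\<Sum>y\<in>Y \<union> Z. if y \<in> Z then \<beta> y * F x y else 0)"
      unfolding sum.distrib[symmetric] \<gamma>_def by (intro sum.cong) (auto simp: algebra_simps)
    also have "\<dots> = (\<Sum>y\<in>(Y \<union> Z) \<inter> Y. \<alpha> y * F x y) + (\<Sum>y\<in>(Y \<union> Z) \<inter> Z. \<beta> y * F x y)"
      using Y(1) Z(1) by (simp only: sum.inter_restrict finite_UnI)
    finally show ?thesis by (simp add: Int_absorb1)
  qed
  have "\<bar>g x + h x - (\<Sum>y\<in>Y \<union> Z. \<gamma> y * F x y)\<bar> \<le> e" if "x \<in> K" for x
    unfolding union using g[OF that] h[OF that] by argo
  with Y Z show "\<exists>Y' \<alpha>'. finite Y' \<and> Y' \<subseteq> S \<and>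
      (\<forall>x\<in>K. \<bar>g x + h x - (\<Sum>y\<in>Y'. \<alpha>' y * F x y)\<bar> \<le> e)"
    by (intro exI[of _ "Y \<union> Z"] exI[of _ \<gamma>]) auto
qed

lemma approximable_cmult:
  assumes "approximable K S F g"
  shows "approximable K S F (\<lambda>x. c * g x)"
  unfolding approximable_def
proof (intro allI impI)
  fix e :: real assume "e > 0"
  then have e': "e / (\<bar>c\<bar> + 1) > 0" by (simp add: add_nonneg_pos)
  obtain Y \<alpha> where Y: "finite Y" "Y \<subseteq> S"
    and g: "\<And>x. x \<in> K \<Longrightarrow> \<bar>g x - (\<Sum>y\<in>Y. \<alpha> y * F x y)\<bar> \<le> e / (\<bar>c\<bar> + 1)"
    using approximableD[OF assms(1) e'] by metis
  have "\<bar>c * g x - (\<Sum>y\<in>Y. (c * \<alpha> y) * F x y)\<bar> \<le> e" if "x \<in> K" for x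
  proof -
    have "\<bar>c * g x - (\<Sum>y\<in>Y. (c * \<alpha> y) * F x y)\<bar> = \<bar>c\<bar> * \<bar>g x - (\<Sum>y\<in>Y. \<alpha> y * F x y)\<bar>"
      by (simp add: abs_mult[symmetric] sum_distrib_left right_diff_distrib mult.assoc)
    also have "\<dots> \<le> (\<bar>c\<bar> + 1) * (e / (\<bar>c\<bar> + 1))"
      using g[OF that] by (intro mult_mono) auto
    also have "\<dots> = e" by (simp add: add_nonneg_pos pos_add_strict) 
    finally show ?thesis .
  qed
  with Y show "\<exists>Y' \<alpha>'. finite Y' \<and> Y' \<subseteq> S \<and> (\<forall>x\<in>K. \<bar>c * g x - (\<Sum>y\<in>Y'. \<alpha>' y * F x y)\<bar> \<le> e)"
    by (intro exI[of _ Y] exI[of _ "\<lambda>y. c * \<alpha> y"]) auto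
qed

lemma approximable_uniform_limit:
  assumes "\<And>e. e > 0 \<Longrightarrow> \<exists>h. approximable K S F h \<and> (\<forall>x\<in>K. \<bar>g x - h x\<bar> \<le> e)"
  shows "approximable K S F g"
  unfolding approximable_def
proof (intro allI impI)
  fix e :: real assume "e > 0"
  then have e2: "e/2 > 0" by simp
  obtain h where h: "approximable K S F h" "\<And>x. x \<in> K \<Longrightarrow> \<bar>g x - h x\<bar> \<le> e/2"
    using assms[OF e2] by blast
  obtain Y \<alpha> where Y: "finite Y" "Y \<subseteq> S"
    and *: "\<And>x. x \<in> K \<Longrightarrow> \<bar>h x - (\<Sum>y\<in>Y. \<alpha> y * F x y)\<bar> \<le> e/2"
    using approximableD[OF h(1) e2] by metis
  have "\<bar>g x - (\<Sum>y\<in>Y. \<alpha> y * F x y)\<bar> \<le> e" if "x \<in> K" for x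
    using h(2)[OF that] *[OF that] by linarith
  with Y show "\<exists>Y \<alpha>. finite Y \<and> Y \<subseteq> S \<and> (\<forall>x\<in>K. \<bar>g x - (\<Sum>y\<in>Y. \<alpha> y * F x y)\<bar> \<le> e)"
    by blast
qed

lemma approximable_cong:
  assumes "approximable K S F g" "\<And>x. x \<in> K \<Longrightarrow> g x = h x"
  shows "approximable K S F h"
  by (rule approximable_uniform_limit) (use assms in auto)

text \<open>
  Approximating in two stages: combinations of sections of \<open>G\<close> are themselves approximated by
  combinations of sections of \<open>F\<close>. It is used for passing from the spline to bumps and from bumps
  to general functions.
\<close>

lemma approximable_trans:
  assumes "approximable K T G g" "\<And>z. z \<in> T \<Longrightarrow> approximable K S F (\<lambda>x. G x z)"
  shows "approximable K S F g"
proof (rule approximable_uniform_limit)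
  fix e :: real assume "e > 0"
  obtain Y \<alpha> where Y: "finite Y" "Y \<subseteq> T"
    and *: "\<And>x. x \<in> K \<Longrightarrow> \<bar>g x - (\<Sum>y\<in>Y. \<alpha> y * G x y)\<bar> \<le> e"
    using approximableD[OF assms(1) \<open>e > 0\<close>] by metis
  have "approximable K S F (\<lambda>x. \<Sum>y\<in>Y. \<alpha> y * G x y)"
    using Y
  proof (induction Y)
    case (insert z Y)
    then have "approximable K S F (\<lambda>x. \<alpha> z * G x z + (\<Sum>y\<in>Y. \<alpha> y * G x y))"
      by (intro approximable_add approximable_cmult assms(2)) auto
    with insert show ?case by simp
  qed (simp add: approximable_zero)
  with * show "\<exists>h. approximable K S F h \<and> (\<forall>x\<in>K. \<bar>g x - h x\<bar> \<le> e)" by blast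
qed

section \<open>Riemann sums of kernel integrals\<close>

text \<open>
  Since \<open>F\<close> is uniformly continuous on \<open>K \<times> S\<close>, replacing \<open>F x y\<close> by \<open>F x t\<close> for \<open>y\<close> in a small cell
  around \<open>t\<close> costs at most \<open>e' \<integral> |w|\<close>, uniformly in \<open>x\<close>. The cells come from a finite cover of \<open>S\<close> by
  balls.
\<close>

lemma approximable_integral:
  fixes F :: "'a::euclidean_space \<Rightarrow> 'b::euclidean_space \<Rightarrow> real" and w :: "'b \<Rightarrow> real"
  assumes K: "compact K" and S: "compact S"
    and F: "continuous_on UNIV (\<lambda>(x, y). F x y)"
    and w: "integrable lborel w" and supp: "\<And>y. y \<notin> S \<Longrightarrow> w y = 0"
  shows "approximable K S F (\<lambda>x. \<integral>y. F x y * w y \<partial>lborel)"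
proof (rule approximable_uniform_limit)
  fix e :: real assume "e > 0"
  define W where "W = (\<integral>y. \<bar>w y\<bar> \<partial>lborel)"
  have "W \<ge> 0" unfolding W_def by simp
  define e' where "e' = e / (W + 1)"
  have "e' > 0" using \<open>e > 0\<close> \<open>W \<ge> 0\<close> by (simp add: e'_def)
  have Fc: "continuous_on UNIV (F x)" for x
  proof -
    have "continuous_on UNIV (\<lambda>y. (x, y))"
      by (intro continuous_intros)
    then have "continuous_on UNIV (\<lambda>y. case (x, y) of (x, y) \<Rightarrow> F x y)"
      by (rule continuous_on_compose2[OF F]) auto
    then show ?thesis by simp
  qed
  have Fm [measurable]: "F x \<in> borel_measurable borel" for x
    by (rule borel_measurable_continuous_onI[OF Fc])
  have wm [measurable]: "w \<in> borel_measurable borel"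
    using w by (simp add: borel_measurable_integrable)
  have KS: "compact (K \<times> S)" by (rule compact_Times[OF K S])
  have FKS: "continuous_on (K \<times> S) (\<lambda>(x, y). F x y)"
    by (rule continuous_on_subset[OF F]) auto
  have "bounded ((\<lambda>(x, y). F x y) ` (K \<times> S))"
    by (rule compact_imp_bounded[OF compact_continuous_image[OF FKS KS]])
  then obtain B where B: "\<And>x y. x \<in> K \<Longrightarrow> y \<in> S \<Longrightarrow> \<bar>F x y\<bar> \<le> B"
    unfolding bounded_iff by fastforce
  have "uniformly_continuous_on (K \<times> S) (\<lambda>(x, y). F x y)"
    by (rule compact_uniformly_continuous[OF FKS KS])
  then obtain \<eta> where "\<eta> > 0" and \<eta>: "\<And>p q. p \<in> K \<times> S \<Longrightarrow> q \<in> K \<times> S \<Longrightarrow> dist q p < \<eta> \<Longrightarrow>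
      dist (case q of (x, y) \<Rightarrow> F x y) (case p of (x, y) \<Rightarrow> F x y) < e'"
    unfolding uniformly_continuous_on_def using \<open>e' > 0\<close> by metis
  have near: "\<bar>F x y - F x t\<bar> \<le> e'" if "x \<in> K" "y \<in> S" "t \<in> S" "dist t y < \<eta>" for x y t
    using \<eta>[of "(x, t)" "(x, y)"] that by (simp add: dist_Pair_Pair dist_real_def dist_commute)
  obtain T where T: "finite T" "T \<subseteq> S" "S \<subseteq> (\<Union>t\<in>T. ball t \<eta>)"
    using compactE_image[OF S, of S "\<lambda>t. ball t \<eta>"] \<open>\<eta> > 0\<close>
    by (metis UN_I centre_in_ball open_ball subsetI)
  have int: "integrable lborel (\<lambda>y. indicator A y * (F x y * w y))"
    if "A \<in> sets borel" "x \<in> K" for A x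
  proof (rule Bochner_Integration.integrable_bound)
    show "integrable lborel (\<lambda>y. B * \<bar>w y\<bar>)" using w by simp
    show "AE y in lborel. norm (indicator A y * (F x y * w y)) \<le> norm (B * \<bar>w y\<bar>)"
    proof (rule AE_I2)
      fix y show "norm (indicator A y * (F x y * w y)) \<le> norm (B * \<bar>w y\<bar>)"
      proof (cases "y \<in> S")
        case True
        then have "\<bar>F x y\<bar> \<le> \<bar>B\<bar>" using B[OF \<open>x \<in> K\<close>] by fastforce
        then have "\<bar>F x y\<bar> * \<bar>w y\<bar> \<le> \<bar>B\<bar> * \<bar>w y\<bar>" by (intro mult_right_mono) auto
        then show ?thesis by (auto simp: indicator_def abs_mult)
      qed (simp add: supp)
    qed
  qed (use that in measurable)
  have intw: "integrable lborel (\<lambda>y. indicator A y * \<bar>w y\<bar>)" if "A \<in> sets borel" for A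
    using w integrable_mult_indicator[of A lborel "\<lambda>y. \<bar>w y\<bar>"] that by simp
  \<comment> \<open>Induction on the number of balls makes the cover disjoint: the part of \<open>A\<close> in one ball
    contributes a single node \<open>t\<close>, and the remaining balls cover the rest of \<open>A\<close>.\<close>
  have cells: "\<exists>\<alpha>. \<forall>x\<in>K. \<bar>(\<integral>y. indicator A y * (F x y * w y) \<partial>lborel) - (\<Sum>t\<in>T. \<alpha> t * F x t)\<bar>
                 \<le> e' * (\<integral>y. indicator A y * \<bar>w y\<bar> \<partial>lborel)"
    if "T \<subseteq> S" "A \<in> sets borel" "A \<subseteq> S" "A \<subseteq> (\<Union>t\<in>T. ball t \<eta>)" for A
    using T(1) that
  proof (induction T arbitrary: A)
    case (insert t T)
    define A1 A2 where "A1 = A \<inter> ball t \<eta>" and "A2 = A - ball t \<eta>"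
    have b: "A1 \<in> sets borel" "A2 \<in> sets borel" using insert.prems by (auto simp: A1_def A2_def)
    have "A2 \<subseteq> S" "A2 \<subseteq> (\<Union>t\<in>T. ball t \<eta>)" using insert.prems unfolding A2_def by auto
    then obtain \<alpha> where \<alpha>: "\<forall>x\<in>K. \<bar>(\<integral>y. indicator A2 y * (F x y * w y) \<partial>lborel) - (\<Sum>t\<in>T. \<alpha> t * F x t)\<bar>
                 \<le> e' * (\<integral>y. indicator A2 y * \<bar>w y\<bar> \<partial>lborel)"
      using insert.IH[of A2] insert.prems b by auto
    define a where "a = (\<integral>y. indicator A1 y * w y \<partial>lborel)"
    have split: "indicator A y = (indicator A1 y + indicator A2 y :: real)" for y
      by (auto simp: A1_def A2_def indicator_def)
    have "\<bar>(\<integral>y. indicator A y * (F x y * w y) \<partial>lborel) - (\<Sum>s\<in>insert t T. (\<alpha>(t := a)) s * F x s)\<bar>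
         \<le> e' * (\<integral>y. indicator A y * \<bar>w y\<bar> \<partial>lborel)" if "x \<in> K" for x
    proof -
      have inta: "integrable lborel (\<lambda>y. indicator A1 y * w y)"
        using w integrable_mult_indicator[of A1 lborel w] b by simp
      have 1: "(\<integral>y. indicator A y * (F x y * w y) \<partial>lborel) =
          (\<integral>y. indicator A1 y * (F x y * w y) \<partial>lborel) + (\<integral>y. indicator A2 y * (F x y * w y) \<partial>lborel)"
        unfolding split distrib_right using int[OF _ that] b by simp
      have 2: "(\<integral>y. indicator A y * \<bar>w y\<bar> \<partial>lborel) =
          (\<integral>y. indicator A1 y * \<bar>w y\<bar> \<partial>lborel) + (\<integral>y. indicator A2 y * \<bar>w y\<bar> \<partial>lborel)"
        unfolding split distrib_right using intw b by simp
      have 3: "(\<Sum>s\<in>insert t T. (\<alpha>(t := a)) s * F x s) = a * F x t + (\<Sum>s\<in>T. \<alpha> s * F x s)"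
      proof -
        have "(\<Sum>s\<in>T. (\<alpha>(t := a)) s * F x s) = (\<Sum>s\<in>T. \<alpha> s * F x s)"
          using insert.hyps by (intro sum.cong) auto
        then show ?thesis using insert.hyps by simp
      qed
      have "(\<integral>y. indicator A1 y * (F x y * w y) \<partial>lborel) - a * F x t =
          (\<integral>y. indicator A1 y * (F x y * w y) - (indicator A1 y * w y) * F x t \<partial>lborel)"
        unfolding a_def using int[OF _ that] b inta by simp
      also have "norm \<dots> \<le> (\<integral>y. e' * (indicator A1 y * \<bar>w y\<bar>) \<partial>lborel)"
      proof (rule Bochner_Integration.integral_norm_bound_integral)
        fix y
        have "\<bar>F x y - F x t\<bar> * \<bar>w y\<bar> \<le> e' * \<bar>w y\<bar>" if "y \<in> A1"
        proof (intro mult_right_mono near)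
          show "x \<in> K" by fact
          show "y \<in> S" "t \<in> S" "dist t y < \<eta>" using that insert.prems by (auto simp: A1_def)
        qed auto
        then show "norm (indicator A1 y * (F x y * w y) - (indicator A1 y * w y) * F x t)
             \<le> e' * (indicator A1 y * \<bar>w y\<bar>)"
          by (auto simp: indicator_def abs_mult[symmetric] algebra_simps)
      qed (use int[OF _ that] b inta intw in auto)
      finally have "\<bar>(\<integral>y. indicator A1 y * (F x y * w y) \<partial>lborel) - a * F x t\<bar>
          \<le> e' * (\<integral>y. indicator A1 y * \<bar>w y\<bar> \<partial>lborel)" by simp
      moreover have "\<bar>(\<integral>y. indicator A2 y * (F x y * w y) \<partial>lborel) - (\<Sum>s\<in>T. \<alpha> s * F x s)\<bar>
          \<le> e' * (\<integral>y. indicator A2 y * \<bar>w y\<bar> \<partial>lborel)"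
        using \<alpha> that by blast
      ultimately show ?thesis unfolding 1 2 3 distrib_left by linarith
    qed
    then show ?case by blast
  qed auto
  obtain \<alpha> where \<alpha>: "\<forall>x\<in>K. \<bar>(\<integral>y. indicator S y * (F x y * w y) \<partial>lborel) - (\<Sum>t\<in>T. \<alpha> t * F x t)\<bar>
                 \<le> e' * (\<integral>y. indicator S y * \<bar>w y\<bar> \<partial>lborel)"
    using cells[OF T(2) _ order_refl T(3)] S by (auto simp: compact_imp_closed)
  have "(\<lambda>y. indicator S y * (F x y * w y)) = (\<lambda>y. F x y * w y)" for x
    using supp by (intro ext) (simp add: indicator_def, metis)
  moreover have "(\<lambda>y. indicator S y * \<bar>w y\<bar>) = (\<lambda>y. \<bar>w y\<bar>)"
    using supp by (intro ext) (simp add: indicator_def, metis)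
  ultimately have *: "\<forall>x\<in>K. \<bar>(\<integral>y. F x y * w y \<partial>lborel) - (\<Sum>t\<in>T. \<alpha> t * F x t)\<bar> \<le> e' * W"
    using \<alpha> unfolding W_def by simp
  have "e' * W \<le> e" using \<open>e > 0\<close> \<open>W \<ge> 0\<close> by (simp add: e'_def field_simps)
  with * have "\<forall>x\<in>K. \<bar>(\<integral>y. F x y * w y \<partial>lborel) - (\<Sum>t\<in>T. \<alpha> t * F x t)\<bar> \<le> e" by force
  then show "\<exists>h. approximable K S F h \<and> (\<forall>x\<in>K. \<bar>(\<integral>y. F x y * w y \<partial>lborel) - h x\<bar> \<le> e)"
    using approximable_finite_sum[OF T(1,2)] by blast
qed

section \<open>Integrals of directional derivatives\<close>

lemma integrable_continuous_bounded_support: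
  fixes g :: "'a::euclidean_space \<Rightarrow> real"
  assumes "continuous_on UNIV g" "\<And>y. y \<notin> cball z R \<Longrightarrow> g y = 0"
  shows "integrable lborel g"
proof -
  have "integrable lborel (\<lambda>y. indicator (cball z R) y *\<^sub>R g y)"
    by (intro borel_integrable_compact compact_cball continuous_on_subset[OF assms(1)]) auto
  moreover have "(\<lambda>y. indicator (cball z R) y *\<^sub>R g y) = g"
  proof
    fix y show "indicator (cball z R) y *\<^sub>R g y = g y"
      using assms(2)[of y] by (cases "y \<in> cball z R") auto
  qed
  ultimately show ?thesis by simp
qed

lemma lborel_integral_translate:
  fixes g :: "'a::euclidean_space \<Rightarrow> real"
  assumes "g \<in> borel_measurable borel"
  shows "(\<integral>y. g (y + c) \<partial>lborel) = (\<integral>y. g y \<partial>lborel)"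
proof -
  have "(\<integral>y. g y \<partial>lborel) = (\<integral>y. g y \<partial>distr lborel borel ((+) c))"
    by (simp add: lborel_distr_plus)
  also have "\<dots> = (\<integral>y. g (c + y) \<partial>lborel)"
    using assms by (subst integral_distr) auto
  finally show ?thesis by (simp add: add.commute)
qed

text \<open>
  The difference quotients of \<open>w\<close> have integral zero by translation invariance, and they converge
  to \<open>g\<close> with a common integrable bound given by the mean value theorem. This replaces an
  integration by parts with Fubini's theorem.
\<close>

lemma integral_directional_derivative_eq_0:
  fixes w g :: "'a::euclidean_space \<Rightarrow> real" and e :: 'a
  assumes deriv: "\<And>y. ((\<lambda>t. w (y + t *\<^sub>R e)) has_real_derivative g y) (at 0)"
    and w: "continuous_on UNIV w" and g: "continuous_on UNIV g"
    and suppw: "\<And>y. y \<notin> cball z R \<Longrightarrow> w y = 0" and suppg: "\<And>y. y \<notin> cball z R \<Longrightarrow> g y = 0"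
  shows "(\<integral>y. g y \<partial>lborel) = 0"
proof -
  define s where "s n y = (w (y + inverse (real (Suc n)) *\<^sub>R e) - w y) / inverse (real (Suc n))" for n y
  have wm [measurable]: "w \<in> borel_measurable borel" and gm [measurable]: "g \<in> borel_measurable borel"
    using w g by (auto intro: borel_measurable_continuous_onI)
  have "bounded (g ` cball z R)"
    by (intro compact_imp_bounded compact_continuous_image continuous_on_subset[OF g]) auto
  then obtain B0 where B0: "\<And>y. y \<in> cball z R \<Longrightarrow> \<bar>g y\<bar> \<le> B0"
    unfolding bounded_iff real_norm_def by blast
  define B where "B = max B0 0"
  have B: "\<bar>g y\<bar> \<le> B" for y
    using B0[of y] suppg[of y] by (cases "y \<in> cball z R") (auto simp: B_def)
  have deriv_t: "((\<lambda>t. w (y + t *\<^sub>R e)) has_real_derivative g (y + a *\<^sub>R e)) (at a)" for y a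
  proof -
    have "((\<lambda>t. w ((y + a *\<^sub>R e) + t *\<^sub>R e)) has_real_derivative g (y + a *\<^sub>R e)) (at (a - a))"
      using deriv[of "y + a *\<^sub>R e"] by simp
    then have "((\<lambda>t. w ((y + a *\<^sub>R e) + (t - a) *\<^sub>R e)) has_real_derivative g (y + a *\<^sub>R e)) (at a)"
      using DERIV_shift[of "\<lambda>t. w ((y + a *\<^sub>R e) + (t - a) *\<^sub>R e)" "g (y + a *\<^sub>R e)" 0 a] by simp
    then show ?thesis by (simp add: algebra_simps)
  qed
  have quotient: "\<bar>s n y\<bar> \<le> B" for n y
  proof -
    obtain t where "w (y + inverse (real (Suc n)) *\<^sub>R e) - w (y + 0 *\<^sub>R e) =
        (inverse (real (Suc n)) - 0) * g (y + t *\<^sub>R e)"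
      using MVT2[of 0 "inverse (real (Suc n))" "\<lambda>t. w (y + t *\<^sub>R e)" "\<lambda>t. g (y + t *\<^sub>R e)"] deriv_t
      by force
    then show ?thesis using B unfolding s_def by (simp add: field_simps)
  qed
  have int_s: "(\<integral>y. s n y \<partial>lborel) = 0" for n
  proof -
    have wi: "integrable lborel w"
      by (rule integrable_continuous_bounded_support[OF w suppw])
    have wi': "integrable lborel (\<lambda>y. w (y + c))" for c
    proof (rule integrable_continuous_bounded_support)
      show "continuous_on UNIV (\<lambda>y. w (y + c))"
        by (intro continuous_on_compose2[OF w] continuous_intros) auto
      show "w (y + c) = 0" if "y \<notin> cball (z - c) R" for y
        using that by (intro suppw) (auto simp: dist_norm algebra_simps)
    qed
    show ?thesis
      unfolding s_def using wi wi' lborel_integral_translate[OF wm] by simp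
  qed
  have "(\<lambda>n. \<integral>y. s n y \<partial>lborel) \<longlonglongrightarrow> (\<integral>y. g y \<partial>lborel)"
  proof (rule integral_dominated_convergence[where w = "\<lambda>y. B * indicator (cball z (R + norm e)) y"])
    show "integrable lborel (\<lambda>y. B * indicator (cball z (R + norm e)) y)"
      by (auto intro!: emeasure_compact_finite)
    show "s n \<in> borel_measurable lborel" for n
      unfolding s_def by measurable
    show "AE y in lborel. (\<lambda>n. s n y) \<longlonglongrightarrow> g y"
    proof (rule AE_I2)
      fix y
      have "((\<lambda>h. (w (y + h *\<^sub>R e) - w y) / h) \<longlongrightarrow> g y) (at 0)"
        using deriv[of y] by (simp add: has_field_derivative_iff)
      moreover have "filterlim (\<lambda>n. inverse (real (Suc n))) (at 0) sequentially"
        unfolding filterlim_at using LIMSEQ_inverse_real_of_nat by simp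
      ultimately show "(\<lambda>n. s n y) \<longlonglongrightarrow> g y"
        unfolding s_def by (rule filterlim_compose)
    qed
    show "AE y in lborel. norm (s n y) \<le> B * indicator (cball z (R + norm e)) y" for n
    proof (rule AE_I2)
      fix y
      show "norm (s n y) \<le> B * indicator (cball z (R + norm e)) y"
      proof (cases "y \<in> cball z (R + norm e)")
        case True
        then show ?thesis using quotient[of n y] by simp
      next
        case False
        then have "dist z y > R + norm e" by simp
        have "norm (inverse (real (Suc n)) *\<^sub>R e) \<le> norm e"
          using mult_right_mono[of "inverse (real (Suc n))" 1 "norm e"] by (simp add: divide_simps)
        moreover have "dist z y \<le> dist z (y + inverse (real (Suc n)) *\<^sub>R e)
              + norm (inverse (real (Suc n)) *\<^sub>R e)"
          using dist_triangle[of z y "y + inverse (real (Suc n)) *\<^sub>R e"] by (simp add: dist_norm)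
        ultimately have "dist z (y + inverse (real (Suc n)) *\<^sub>R e) > R" "dist z y > R"
          using \<open>dist z y > R + norm e\<close> norm_ge_zero[of e] by linarith+
        then show ?thesis using False by (simp add: s_def suppw)
      qed
    qed
  qed simp
  then show ?thesis by (simp add: int_s LIMSEQ_const_iff)
qed

section \<open>Green's identity for radial functions\<close>

text \<open>
  If \<open>F\<close> and \<open>G\<close> are related, then \<open>G(|x|\<^sup>2)\<close> is the Laplacian of \<open>F(|x|\<^sup>2)\<close> on a space of dimension
  \<open>d\<close>. It is a relation, so that its relational powers express iterated Laplacians together
  with the smoothness that they need. The conditions are imposed for \<open>t \<ge> 0\<close> because \<open>t = |x|\<^sup>2\<close>.
\<close>

definition radial_laplacian :: "real \<Rightarrow> (real \<Rightarrow> real) \<Rightarrow> (real \<Rightarrow> real) \<Rightarrow> bool" where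
  "radial_laplacian d F G \<longleftrightarrow> (\<exists>F1 F2.
     (\<forall>t\<ge>0. (F has_real_derivative F1 t) (at t)) \<and>
     (\<forall>t\<ge>0. (F1 has_real_derivative F2 t) (at t)) \<and>
     continuous_on {0..} F2 \<and>
     (\<forall>t\<ge>0. G t = 4 * t * F2 t + 2 * d * F1 t))"

lemma radial_laplacianE:
  assumes "radial_laplacian d F G"
  obtains F1 F2 where
    "\<And>t. t \<ge> 0 \<Longrightarrow> (F has_real_derivative F1 t) (at t)"
    "\<And>t. t \<ge> 0 \<Longrightarrow> (F1 has_real_derivative F2 t) (at t)"
    "continuous_on {0..} F2"
    "\<And>t. t \<ge> 0 \<Longrightarrow> G t = 4 * t * F2 t + 2 * d * F1 t"
  using assms unfolding radial_laplacian_def by metis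

lemma radial_laplacian_continuous:
  assumes "radial_laplacian d F G"
  shows "continuous_on {0..} F" "continuous_on {0..} G"
proof -
  obtain F1 F2 where F:
    "\<And>t. t \<ge> 0 \<Longrightarrow> (F has_real_derivative F1 t) (at t)"
    "\<And>t. t \<ge> 0 \<Longrightarrow> (F1 has_real_derivative F2 t) (at t)"
    "continuous_on {0..} F2"
    "\<And>t. t \<ge> 0 \<Longrightarrow> G t = 4 * t * F2 t + 2 * d * F1 t"
    using radial_laplacianE[OF assms] by metis
  show "continuous_on {0..} F"
    by (rule DERIV_continuous_on[of _ _ F1]) (auto intro: has_field_derivative_at_within F)
  have "continuous_on {0..} F1"
    by (rule DERIV_continuous_on[of _ _ F2]) (auto intro: has_field_derivative_at_within F)
  then have "continuous_on {0..} (\<lambda>t. 4 * t * F2 t + 2 * d * F1 t)"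
    by (intro continuous_intros F(3))
  then show "continuous_on {0..} G"
    by (rule continuous_on_eq) (auto simp: F(4))
qed

lemma radial_laplacian_cmult:
  assumes "radial_laplacian d F G"
  shows "radial_laplacian d (\<lambda>t. c * F t) (\<lambda>t. c * G t)"
proof -
  obtain F1 F2 where F:
    "\<And>t. t \<ge> 0 \<Longrightarrow> (F has_real_derivative F1 t) (at t)"
    "\<And>t. t \<ge> 0 \<Longrightarrow> (F1 has_real_derivative F2 t) (at t)"
    "continuous_on {0..} F2"
    "\<And>t. t \<ge> 0 \<Longrightarrow> G t = 4 * t * F2 t + 2 * d * F1 t"
    using radial_laplacianE[OF assms] by metis
  show ?thesis
    unfolding radial_laplacian_def
    by (rule exI[of _ "\<lambda>t. c * F1 t"], rule exI[of _ "\<lambda>t. c * F2 t"])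
      (auto intro!: DERIV_cmult F continuous_on_mult_left simp: F(4) algebra_simps)
qed

lemma radial_laplacian_add:
  assumes "radial_laplacian d F G" "radial_laplacian d F' G'"
  shows "radial_laplacian d (\<lambda>t. F t + F' t) (\<lambda>t. G t + G' t)"
proof -
  obtain F1 F2 where F:
    "\<And>t. t \<ge> 0 \<Longrightarrow> (F has_real_derivative F1 t) (at t)"
    "\<And>t. t \<ge> 0 \<Longrightarrow> (F1 has_real_derivative F2 t) (at t)"
    "continuous_on {0..} F2"
    "\<And>t. t \<ge> 0 \<Longrightarrow> G t = 4 * t * F2 t + 2 * d * F1 t"
    using radial_laplacianE[OF assms(1)] by metis
  obtain F1' F2' where F':
    "\<And>t. t \<ge> 0 \<Longrightarrow> (F' has_real_derivative F1' t) (at t)"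
    "\<And>t. t \<ge> 0 \<Longrightarrow> (F1' has_real_derivative F2' t) (at t)"
    "continuous_on {0..} F2'"
    "\<And>t. t \<ge> 0 \<Longrightarrow> G' t = 4 * t * F2' t + 2 * d * F1' t"
    using radial_laplacianE[OF assms(2)] by metis
  show ?thesis
    unfolding radial_laplacian_def
    by (rule exI[of _ "\<lambda>t. F1 t + F1' t"], rule exI[of _ "\<lambda>t. F2 t + F2' t"])
      (intro conjI allI impI DERIV_add[OF F(1) F'(1)] DERIV_add[OF F(2) F'(2)]
        continuous_on_add[OF F(3) F'(3)]; simp add: F(4) F'(4) algebra_simps)
qed

lemma radial_laplacian_sum:
  assumes "finite I" "\<And>i. i \<in> I \<Longrightarrow> radial_laplacian d (F i) (G i)"
  shows "radial_laplacian d (\<lambda>t. \<Sum>i\<in>I. F i t) (\<lambda>t. \<Sum>i\<in>I. G i t)"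
  using assms
proof (induction I)
  case empty
  show ?case unfolding radial_laplacian_def
    by (rule exI[of _ "\<lambda>t. 0"], rule exI[of _ "\<lambda>t. 0"]) auto
next
  case (insert i I)
  then show ?case using radial_laplacian_add[of d "F i" "G i"] by simp
qed

lemma radial_laplacian_cong:
  assumes "radial_laplacian d F G" "\<And>t. t \<ge> 0 \<Longrightarrow> G t = G' t"
  shows "radial_laplacian d F G'"
  using assms unfolding radial_laplacian_def by metis

lemma derivative_vanishes_beyond:
  fixes f :: "real \<Rightarrow> real"
  assumes "\<And>t. t > R \<Longrightarrow> f t = 0" "(f has_real_derivative D) (at t)" "t > R"
  shows "D = 0"
proof -
  have "((\<lambda>_. 0) has_real_derivative D) (at t)"
    using assms(2)
  proof (rule has_field_derivative_transform_within_open)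
    show "open {R<..}" "t \<in> {R<..}" using assms by auto
  qed (use assms in auto)
  then show ?thesis using DERIV_unique DERIV_const by blast
qed

lemma radial_laplacian_support:
  assumes "radial_laplacian d F G" "\<And>t. t > R \<Longrightarrow> F t = 0" "R \<ge> 0" "t > R"
  shows "G t = 0"
proof -
  obtain F1 F2 where F:
    "\<And>t. t \<ge> 0 \<Longrightarrow> (F has_real_derivative F1 t) (at t)"
    "\<And>t. t \<ge> 0 \<Longrightarrow> (F1 has_real_derivative F2 t) (at t)"
    "continuous_on {0..} F2"
    "\<And>t. t \<ge> 0 \<Longrightarrow> G t = 4 * t * F2 t + 2 * d * F1 t"
    using radial_laplacianE[OF assms(1)] by metis
  have F1: "F1 t = 0" if "t > R" for t
    using derivative_vanishes_beyond[of R F "F1 t" t] assms(2,3) F(1) that by auto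
  have "F2 t = 0" using derivative_vanishes_beyond[of R F1 "F2 t" t] F1 F(2) assms by auto
  then show ?thesis using F(4) F1 assms by auto
qed

text \<open>
  For every basis vector \<open>i\<close> the field \<open>w i = A \<partial>\<^sub>i B - B \<partial>\<^sub>i A\<close> has compact support, and the mixed
  terms in its derivative \<open>g i\<close> along \<open>i\<close> cancel. Summing \<open>g i\<close> over the basis gives \<open>A \<Delta>B - B \<Delta>A\<close>.
  There are two centres because \<open>x\<close> will be the point of evaluation and \<open>z\<close> the centre of a bump.
\<close>

lemma radial_green:
  fixes x z :: "'a::euclidean_space"
  assumes A: "radial_laplacian (real DIM('a)) A A'" and B: "radial_laplacian (real DIM('a)) B B'"
    and supp: "\<And>t. t > R \<Longrightarrow> B t = 0" "R \<ge> 0"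
  shows "(\<integral>y. A ((norm (y - x))\<^sup>2) * B' ((norm (y - z))\<^sup>2) \<partial>lborel) =
         (\<integral>y. A' ((norm (y - x))\<^sup>2) * B ((norm (y - z))\<^sup>2) \<partial>lborel)"
proof -
  obtain A1 A2 where A12:
    "\<And>t. t \<ge> 0 \<Longrightarrow> (A has_real_derivative A1 t) (at t)"
    "\<And>t. t \<ge> 0 \<Longrightarrow> (A1 has_real_derivative A2 t) (at t)"
    "continuous_on {0..} A2"
    "\<And>t. t \<ge> 0 \<Longrightarrow> A' t = 4 * t * A2 t + 2 * real DIM('a) * A1 t"
    using radial_laplacianE[OF A] by metis
  obtain B1 B2 where B12:
    "\<And>t. t \<ge> 0 \<Longrightarrow> (B has_real_derivative B1 t) (at t)"
    "\<And>t. t \<ge> 0 \<Longrightarrow> (B1 has_real_derivative B2 t) (at t)"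
    "continuous_on {0..} B2"
    "\<And>t. t \<ge> 0 \<Longrightarrow> B' t = 4 * t * B2 t + 2 * real DIM('a) * B1 t"
    using radial_laplacianE[OF B] by metis
  have suppB1: "B1 t = 0" if "t > R" for t
    using derivative_vanishes_beyond[of R B "B1 t" t] supp B12(1) that by auto
  have suppB2: "B2 t = 0" if "t > R" for t
    using derivative_vanishes_beyond[of R B1 "B2 t" t] suppB1 supp B12(2) that by auto
  have cont: "continuous_on {0..} A" "continuous_on {0..} A1" "continuous_on {0..} B" "continuous_on {0..} B1"
    by (rule DERIV_continuous_on, auto intro: has_field_derivative_at_within A12 B12)+
  define q :: "'a \<Rightarrow> 'a \<Rightarrow> real" where "q c y = (norm (y - c))\<^sup>2" for c y
  have cq: "continuous_on UNIV (\<lambda>y. f (q c y))" if "continuous_on {0..} f" for f :: "real \<Rightarrow> real" and c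
    unfolding q_def by (rule continuous_on_compose2[OF that]) (auto intro!: continuous_intros)
  have dq: "((\<lambda>t. f (q c (y + t *\<^sub>R i))) has_real_derivative f' (q c y) * (2 * ((y - c) \<bullet> i))) (at 0)"
    if "\<And>t. t \<ge> 0 \<Longrightarrow> (f has_real_derivative f' t) (at t)" for f f' :: "real \<Rightarrow> real" and c y i
  proof -
    have "q c (y + t *\<^sub>R i) = q c y + 2 * t * ((y - c) \<bullet> i) + t\<^sup>2 * (i \<bullet> i)" for t
      unfolding q_def power2_norm_eq_inner
      by (simp add: inner_add inner_diff inner_commute power2_eq_square algebra_simps)
    then have "((\<lambda>t. q c (y + t *\<^sub>R i)) has_real_derivative 2 * ((y - c) \<bullet> i)) (at 0)"
      by (auto intro!: derivative_eq_intros)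
    moreover have "(f has_real_derivative f' (q c y)) (at (q c (y + 0 *\<^sub>R i)))"
      using that[of "q c y"] by (simp add: q_def)
    ultimately show ?thesis by (rule DERIV_chain2[rotated])
  qed
  define w where "w i y = A (q x y) * (2 * ((y - z) \<bullet> i) * B1 (q z y))
                        - 2 * ((y - x) \<bullet> i) * A1 (q x y) * B (q z y)" for i y
  define g where "g i y = A (q x y) * (2 * B1 (q z y) + 4 * ((y - z) \<bullet> i)\<^sup>2 * B2 (q z y))
                        - (2 * A1 (q x y) + 4 * ((y - x) \<bullet> i)\<^sup>2 * A2 (q x y)) * B (q z y)" for i y
  have outside: "q z y > R" if "y \<notin> cball z (sqrt R)" for y
  proof -
    have "sqrt R < norm (y - z)" using that by (simp add: dist_norm norm_minus_commute)
    then have "(sqrt R)\<^sup>2 < (norm (y - z))\<^sup>2" using supp by (intro power_strict_mono) auto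
    then show ?thesis using supp by (simp add: q_def)
  qed
  have cg: "continuous_on UNIV (g i)" for i
    unfolding g_def by (intro continuous_intros cq cont A12(3) B12(3))
  have suppg: "g i y = 0" if "y \<notin> cball z (sqrt R)" for i y
    using outside[OF that] by (simp add: g_def supp suppB1 suppB2)
  have zero: "(\<integral>y. g i y \<partial>lborel) = 0" if i: "i \<in> Basis" for i
  proof (rule integral_directional_derivative_eq_0)
    fix y :: 'a
    have [simp]: "i \<bullet> i = 1" using i by simp
    have lin: "((\<lambda>t. (y + t *\<^sub>R i - c) \<bullet> i) has_real_derivative 1) (at 0)" for c
      by (auto simp: inner_add inner_diff intro!: derivative_eq_intros)
    note dA = dq[OF A12(1), of x y i] and dA1 = dq[OF A12(2), of x y i]
      and dB = dq[OF B12(1), of z y i] and dB1 = dq[OF B12(2), of z y i]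
    show "((\<lambda>t. w i (y + t *\<^sub>R i)) has_real_derivative g i y) (at 0)"
      unfolding w_def g_def
      by (rule DERIV_cong[OF DERIV_diff[OF
              DERIV_mult[OF dA DERIV_mult[OF DERIV_cmult[OF lin[of z], of 2] dB1]]
              DERIV_mult[OF DERIV_mult[OF DERIV_cmult[OF lin[of x], of 2] dA1] dB]]])
        (assumption | (simp only: scaleR_zero_left add_0_right, algebra))+
    show "continuous_on UNIV (w i)"
      unfolding w_def by (intro continuous_intros cq cont A12(3) B12(3))
  next
    fix y assume "y \<notin> cball z (sqrt R)"
    from outside[OF this] show "w i y = 0" by (simp add: w_def supp suppB1)
  qed (use cg suppg in auto)
  have gi: "integrable lborel (g i)" for i
    by (rule integrable_continuous_bounded_support[OF cg suppg])
  have sq: "(\<Sum>i\<in>Basis. ((y - c) \<bullet> i)\<^sup>2) = q c y" for c y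
    unfolding q_def power2_norm_eq_inner euclidean_inner[of "y - c" "y - c"] by (simp add: power2_eq_square)
  have "(\<Sum>i\<in>Basis. g i y) = A (q x y) * B' (q z y) - A' (q x y) * B (q z y)" for y
  proof -
    have q0: "q c y \<ge> 0" for c by (simp add: q_def)
    have "(\<Sum>i\<in>Basis. g i y) =
        A (q x y) * (2 * real DIM('a) * B1 (q z y) + 4 * (\<Sum>i\<in>Basis. ((y - z) \<bullet> i)\<^sup>2) * B2 (q z y))
        - (2 * real DIM('a) * A1 (q x y) + 4 * (\<Sum>i\<in>Basis. ((y - x) \<bullet> i)\<^sup>2) * A2 (q x y)) * B (q z y)"
      unfolding g_def
      by (simp add: sum_subtractf sum.distrib sum_distrib_left sum_distrib_right distrib_left distrib_right mult.assoc mult.left_commute)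
    then show ?thesis unfolding sq A12(4)[OF q0] B12(4)[OF q0] by (simp add: algebra_simps)
  qed
  moreover have "(\<integral>y. (\<Sum>i\<in>Basis. g i y) \<partial>lborel) = 0"
    using gi zero by (simp add: Bochner_Integration.integral_sum)
  ultimately have "(\<integral>y. A (q x y) * B' (q z y) - A' (q x y) * B (q z y) \<partial>lborel) = 0" by simp
  moreover have "integrable lborel (\<lambda>y. A (q x y) * B' (q z y))"
    by (rule integrable_continuous_bounded_support[of _ z "sqrt R"])
      (auto intro!: continuous_intros cq cont radial_laplacian_continuous[OF B]
        simp: radial_laplacian_support[OF B supp] dest!: outside[simplified])
  moreover have "integrable lborel (\<lambda>y. A' (q x y) * B (q z y))"
    by (rule integrable_continuous_bounded_support[of _ z "sqrt R"])
      (auto intro!: continuous_intros cq cont radial_laplacian_continuous[OF A]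
        simp: supp dest!: outside[simplified])
  ultimately show ?thesis unfolding q_def by simp
qed

lemma radial_laplacian_power_support:
  assumes "(radial_laplacian d ^^ k) F G" "\<And>t. t > R \<Longrightarrow> F t = 0" "R \<ge> 0" "t > R"
  shows "G t = 0"
  using assms(1,4)
proof (induction k arbitrary: G t)
  case 0
  then show ?case using assms by simp
next
  case (Suc k)
  then obtain H where H: "(radial_laplacian d ^^ k) F H" "radial_laplacian d H G" by auto
  show ?case
    by (rule radial_laplacian_support[OF H(2) Suc.IH[OF H(1)] assms(3) Suc.prems(2)])
qed

lemma radial_laplacian_power_cmult:
  "(radial_laplacian d ^^ k) F G \<Longrightarrow> (radial_laplacian d ^^ k) (\<lambda>t. c * F t) (\<lambda>t. c * G t)"
proof (induction k arbitrary: G)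
  case (Suc k)
  then obtain H where "(radial_laplacian d ^^ k) F H" "radial_laplacian d H G" by auto
  then show ?case using Suc.IH radial_laplacian_cmult by (meson relpowp_Suc_I)
qed simp

lemma radial_laplacian_power_add:
  "(radial_laplacian d ^^ k) F G \<Longrightarrow> (radial_laplacian d ^^ k) F' G' \<Longrightarrow>
   (radial_laplacian d ^^ k) (\<lambda>t. F t + F' t) (\<lambda>t. G t + G' t)"
proof (induction k arbitrary: G G')
  case (Suc k)
  then obtain H H' where "(radial_laplacian d ^^ k) F H" "radial_laplacian d H G"
    "(radial_laplacian d ^^ k) F' H'" "radial_laplacian d H' G'" by auto
  then show ?case using Suc.IH radial_laplacian_add by (meson relpowp_Suc_I)
qed simp

text \<open>
  Laplacians are moved one at a time: the first one applied to \<open>B\<close> becomes the last one applied to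
  \<open>A\<close>.
\<close>

lemma radial_green_iterated:
  fixes x z :: "'a::euclidean_space"
  assumes "(radial_laplacian (real DIM('a)) ^^ k) A A'" "(radial_laplacian (real DIM('a)) ^^ k) B B'"
    and "\<And>t. t > R \<Longrightarrow> B t = 0" "R \<ge> 0"
  shows "(\<integral>y. A ((norm (y - x))\<^sup>2) * B' ((norm (y - z))\<^sup>2) \<partial>lborel) =
         (\<integral>y. A' ((norm (y - x))\<^sup>2) * B ((norm (y - z))\<^sup>2) \<partial>lborel)"
  using assms
proof (induction k arbitrary: A' B)
  case (Suc k)
  obtain H where H: "(radial_laplacian (real DIM('a)) ^^ k) A H" "radial_laplacian (real DIM('a)) H A'"
    using Suc.prems(1) by auto
  obtain L where L: "radial_laplacian (real DIM('a)) B L" "(radial_laplacian (real DIM('a)) ^^ k) L B'"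
    using relpowp_Suc_D2[OF Suc.prems(2)] by blast
  show ?case
    by (rule trans[OF Suc.IH[OF H(1) L(2)] radial_green[OF H(2) L(1) Suc.prems(3,4)]])
      (use radial_laplacian_support[OF L(1) Suc.prems(3,4)] Suc.prems(4) in auto)
qed simp

section \<open>Iterated Laplacians of the regularised spline\<close>

definition falling :: "real \<Rightarrow> nat \<Rightarrow> real" where
  "falling a n = (\<Prod>i<n. a - real i)"

lemma falling_0 [simp]: "falling a 0 = 1"
  by (simp add: falling_def)

lemma falling_Suc: "falling a (Suc n) = falling a n * (a - real n)"
  by (simp add: falling_def)

lemma falling_Suc_shift: "falling a (Suc n) = a * falling (a - 1) n"
  unfolding falling_def by (simp add: prod.lessThan_Suc_shift algebra_simps del: prod.lessThan_Suc)

lemma falling_eq_0: "i < n \<Longrightarrow> falling (real i) n = 0"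
  unfolding falling_def by (rule prod_zero) auto

lemma falling_nonzero:
  assumes "\<And>i. i < n \<Longrightarrow> a \<noteq> real i"
  shows "falling a n \<noteq> 0"
  using assms by (simp add: falling_def)

lemma falling_differentiable: "\<exists>D. ((\<lambda>a. falling (a + c) n) has_real_derivative D) (at a)"
proof (induction n)
  case (Suc n)
  then obtain D where D: "((\<lambda>a. falling (a + c) n) has_real_derivative D) (at a)" by blast
  have "((\<lambda>a. a + c - real n) has_real_derivative 1) (at a)"
    by (auto intro!: derivative_eq_intros)
  from DERIV_mult[OF D this] show ?case unfolding falling_Suc by blast
qed (auto intro!: exI[of _ 0])

text \<open>
  At the root \<open>i\<close> the derivative is the product of the other factors. In even dimensions this is the
  source of the nonzero constant \<open>C\<close> in \<open>regularised_spline_iterates\<close>.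
\<close>

lemma falling_simple_root:
  assumes "i < n"
  shows "\<exists>D. D \<noteq> 0 \<and> ((\<lambda>a. falling a n) has_real_derivative D) (at (real i))"
proof -
  define r where "r a = (\<Prod>l\<in>{..<n} - {i}. a - real l)" for a
  have split: "falling a n = (a - real i) * r a" for a
    unfolding falling_def r_def using assms by (subst prod.remove[of _ i]) auto
  have "isCont r (real i)"
    unfolding r_def by (intro continuous_intros)
  then have "((\<lambda>a. (a - real i) * r a) has_real_derivative r (real i)) (at (real i))"
    unfolding CARAT_DERIV by (intro exI[of _ r]) simp
  moreover have "r (real i) \<noteq> 0" by (auto simp: r_def)
  ultimately show ?thesis unfolding split by blast
qed

text \<open>
  With \<open>s = |x|\<^sup>2 + E\<close> and \<open>\<beta> = d/2 - 1\<close>, these are the coefficients in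
  \<open>\<Delta>\<^sup>m s\<^sup>a = \<Sum>\<^sub>j power_coeff E \<beta> m j a \<cdot> s powr (a - m - j)\<close>. The product form is what makes them
  useful: for \<open>m = k\<close> and \<open>a = k - d/2\<close> one has \<open>a + \<beta> = k - 1\<close>, so that the last factor vanishes
  for all \<open>j < k\<close>.
\<close>

definition power_coeff :: "real \<Rightarrow> real \<Rightarrow> nat \<Rightarrow> nat \<Rightarrow> real \<Rightarrow> real" where
  "power_coeff E \<beta> m j a =
     4 ^ m * (- E) ^ j * real (m choose j) * falling a (m + j) * falling (a + (\<beta> - real j)) (m - j)"

text \<open>
  One more Laplacian sends \<open>s powr b\<close> to \<open>4 b (b + \<beta>) \<cdot> s powr (b - 1) - 4 E b (b - 1) \<cdot> s powr (b - 2)\<close>.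
  The recursion therefore joins the terms \<open>j\<close> and \<open>j - 1\<close>, much like
  Pascal's rule, and it comes down to \<open>(i + 1) \<cdot> (m choose i + 1) = (m - i) \<cdot> (m choose i)\<close>.
\<close>

lemma power_coeff_Suc:
  "power_coeff E \<beta> (Suc m) j a =
     power_coeff E \<beta> m j a * (4 * (a - real m - real j) * (a - real m - real j + \<beta>)) +
     (if j = 0 then 0 else power_coeff E \<beta> m (j - 1) a *
        (- 4 * E * (a - real m - real (j - 1)) * (a - real m - real (j - 1) - 1)))"
proof (cases j)
  case 0
  have "falling (a + \<beta>) (Suc m) = falling (a + \<beta>) m * (a + \<beta> - real m)"
    by (rule falling_Suc)
  then show ?thesis using 0 by (simp add: power_coeff_def falling_Suc algebra_simps)
next
  case (Suc i)
  show ?thesis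
  proof (cases "i < m")
    case False
    then show ?thesis
      using Suc by (cases "i = m") (simp_all add: power_coeff_def falling_Suc algebra_simps binomial_eq_0)
  next
    case True
    define b P where "b = a + \<beta>" and "P = falling (b - real (Suc i)) (m - Suc i)"
    have m: "m - i = Suc (m - Suc i)" using True by simp
    have P1: "falling (b - real (Suc i)) (m - i) = P * (b - real m)"
      unfolding m falling_Suc P_def using True by (simp add: of_nat_diff algebra_simps)
    have P2: "falling (b - real i) (m - i) = (b - real i) * P"
      unfolding m falling_Suc_shift P_def by (simp add: algebra_simps)
    have "Suc i * (m choose Suc i) = (m - i) * (m choose i)"
      using binomial_absorb_comp[of m i] binomial_absorption[of i m] by simp
    then have "real (Suc i) * real (m choose Suc i) = real (m - i) * real (m choose i)"
      by (simp only: of_nat_mult[symmetric])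
    moreover have "real (m - i) = real m - real i" using True by simp
    ultimately have bin: "real (Suc i) * real (m choose Suc i) = (real m - real i) * real (m choose i)"
      by simp
    have key: "real (Suc m choose Suc i) * (b - real m) =
        real (m choose Suc i) * (b - real m - real (Suc i)) + real (m choose i) * (b - real i)"
      using bin by (simp add: algebra_simps)
    define Q where "Q = falling a (m + i) * (a - real (m + i)) * (a - real (Suc (m + i)))"
    have Q: "falling a (Suc m + Suc i) = Q"
      unfolding Q_def by (simp add: falling_Suc)
    have Q2: "falling a (m + Suc i) = falling a (m + i) * (a - real (m + i))"
      by (simp add: falling_Suc)
    have sh: "a + (\<beta> - real l) = b - real l" for l by (simp add: b_def)
    have "power_coeff E \<beta> (Suc m) (Suc i) a =
        4 ^ Suc m * (- E) ^ Suc i * Q * P * (real (Suc m choose Suc i) * (b - real m))"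
      unfolding power_coeff_def Q sh by (simp add: P1 del: binomial_Suc_Suc of_nat_Suc)
    also have "\<dots> = 4 ^ Suc m * (- E) ^ Suc i * Q * P *
        (real (m choose Suc i) * (b - real m - real (Suc i)) + real (m choose i) * (b - real i))"
      unfolding key ..
    also have "\<dots> = power_coeff E \<beta> m (Suc i) a * (4 * (a - real m - real (Suc i)) * (a - real m - real (Suc i) + \<beta>))
        + power_coeff E \<beta> m i a * (- 4 * E * (a - real m - real i) * (a - real m - real i - 1))"
      unfolding power_coeff_def sh P2 Q2 P_def[symmetric] Q_def
      by (simp add: b_def algebra_simps)
    finally show ?thesis using Suc by simp
  qed
qed

lemma power_coeff_beyond: "m < j \<Longrightarrow> power_coeff E \<beta> m j a = 0"
  by (simp add: power_coeff_def binomial_eq_0)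

lemma power_coeff_derivative:
  "(power_coeff E \<beta> m j has_real_derivative deriv (power_coeff E \<beta> m j) a) (at a)"
proof -
  obtain D1 where D1: "((\<lambda>a. falling (a + 0) (m + j)) has_real_derivative D1) (at a)"
    using falling_differentiable by blast
  obtain D2 where D2: "((\<lambda>a. falling (a + (\<beta> - real j)) (m - j)) has_real_derivative D2) (at a)"
    using falling_differentiable by blast
  have "\<exists>D. (power_coeff E \<beta> m j has_real_derivative D) (at a)"
    using DERIV_cmult[OF DERIV_mult[OF D1 D2], of "4 ^ m * (- E) ^ j * real (m choose j)"]
    unfolding power_coeff_def[abs_def] by (auto simp: mult.assoc)
  then show ?thesis using DERIV_imp_deriv by blast
qed

text \<open>
  The recursion differentiated with respect to the exponent \<open>a\<close>, as the logarithmic case requires.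
\<close>

lemma deriv_power_coeff_Suc:
  "deriv (power_coeff E \<beta> (Suc m) j) a =
     (deriv (power_coeff E \<beta> m j) a * (4 * (a - real m - real j) * (a - real m - real j + \<beta>))
      + power_coeff E \<beta> m j a * (4 * (2 * (a - real m - real j) + \<beta>))) +
     (if j = 0 then 0 else
        deriv (power_coeff E \<beta> m (j - 1)) a *
        (- 4 * E * (a - real m - real (j - 1)) * (a - real m - real (j - 1) - 1))
        + power_coeff E \<beta> m (j - 1) a * (- 4 * E * (2 * (a - real m - real (j - 1)) - 1)))"
proof (rule DERIV_imp_deriv)
  have 1: "((\<lambda>a. 4 * (a - real m - real j) * (a - real m - real j + \<beta>)) has_real_derivative
      4 * (2 * (a - real m - real j) + \<beta>)) (at a)"
    by (auto intro!: derivative_eq_intros simp: algebra_simps)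
  have 2: "((\<lambda>a. - 4 * E * (a - real m - real (j - 1)) * (a - real m - real (j - 1) - 1)) has_real_derivative
      - 4 * E * (2 * (a - real m - real (j - 1)) - 1)) (at a)"
    by (auto intro!: derivative_eq_intros simp: algebra_simps)
  note D1 = DERIV_mult[OF power_coeff_derivative[of E \<beta> m j a] 1]
  note D2 = DERIV_mult[OF power_coeff_derivative[of E \<beta> m "j - 1" a] 2]
  show "(power_coeff E \<beta> (Suc m) j has_real_derivative
     (deriv (power_coeff E \<beta> m j) a * (4 * (a - real m - real j) * (a - real m - real j + \<beta>))
      + power_coeff E \<beta> m j a * (4 * (2 * (a - real m - real j) + \<beta>))) +
     (if j = 0 then 0 else
        deriv (power_coeff E \<beta> m (j - 1)) a *
        (- 4 * E * (a - real m - real (j - 1)) * (a - real m - real (j - 1) - 1))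
        + power_coeff E \<beta> m (j - 1) a * (- 4 * E * (2 * (a - real m - real (j - 1)) - 1)))) (at a)"
  proof (cases "j = 0")
    case True
    have "power_coeff E \<beta> (Suc m) j = (\<lambda>a. power_coeff E \<beta> m j a * (4 * (a - real m - real j) * (a - real m - real j + \<beta>)))"
      using True by (intro ext, subst power_coeff_Suc) simp
    then show ?thesis using DERIV_cong[OF D1] True by (simp add: algebra_simps)
  next
    case False
    have "power_coeff E \<beta> (Suc m) j = (\<lambda>a. power_coeff E \<beta> m j a * (4 * (a - real m - real j) * (a - real m - real j + \<beta>))
       + power_coeff E \<beta> m (j - 1) a * (- 4 * E * (a - real m - real (j - 1)) * (a - real m - real (j - 1) - 1)))"
      using False by (intro ext, subst power_coeff_Suc) simp
    then show ?thesis using DERIV_cong[OF DERIV_add[OF D1 D2]] False by (simp only: if_False, simp add: add_ac mult_ac)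
  qed
qed

lemma DERIV_powr_shift:
  assumes "t + E > (0::real)"
  shows "((\<lambda>t. (t + E) powr b) has_real_derivative b * (t + E) powr (b - 1)) (at t)"
  using assms by (auto intro!: derivative_eq_intros simp: powr_diff)

lemma radial_laplacian_powr:
  assumes "E > 0"
  shows "radial_laplacian d (\<lambda>t. (t + E) powr b)
    (\<lambda>t. 4 * b * (b + (d / 2 - 1)) * (t + E) powr (b - 1) + - 4 * E * b * (b - 1) * (t + E) powr (b - 2))"
  unfolding radial_laplacian_def
proof (intro exI conjI allI impI)
  fix t :: real assume "t \<ge> 0"
  then have pos: "t + E > 0" using assms by simp
  show "((\<lambda>t. (t + E) powr b) has_real_derivative b * (t + E) powr (b - 1)) (at t)"
    by (rule DERIV_powr_shift[OF pos])
  show "((\<lambda>t. b * (t + E) powr (b - 1)) has_real_derivative b * (b - 1) * (t + E) powr (b - 2)) (at t)"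
    by (rule DERIV_cong[OF DERIV_cmult[OF DERIV_powr_shift[OF pos]]]) (simp add: algebra_simps)
  have "(t + E) powr (b - 1) = (t + E) powr (b - 2) * (t + E)"
    using pos by (simp add: powr_diff powr_numeral power2_eq_square)
  then show "4 * b * (b + (d / 2 - 1)) * (t + E) powr (b - 1) + - 4 * E * b * (b - 1) * (t + E) powr (b - 2) =
      4 * t * (b * (b - 1) * (t + E) powr (b - 2)) + 2 * d * (b * (t + E) powr (b - 1))"
    by (simp add: algebra_simps)
next
  show "continuous_on {0..} (\<lambda>t. b * (b - 1) * (t + E) powr (b - 2))"
    using assms by (intro continuous_intros) auto
qed

lemma radial_laplacian_powr_ln:
  assumes "E > 0"
  shows "radial_laplacian d (\<lambda>t. (t + E) powr b * ln (t + E))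
    (\<lambda>t. 4 * b * (b + (d / 2 - 1)) * ((t + E) powr (b - 1) * ln (t + E))
       + 4 * (2 * b + (d / 2 - 1)) * (t + E) powr (b - 1)
       + (- 4 * E * b * (b - 1) * ((t + E) powr (b - 2) * ln (t + E))
       + - 4 * E * (2 * b - 1) * (t + E) powr (b - 2)))"
  unfolding radial_laplacian_def
proof (intro exI conjI allI impI)
  fix t :: real assume "t \<ge> 0"
  then have pos: "t + E > 0" using assms by simp
  have D: "((\<lambda>t. (t + E) powr c * ln (t + E)) has_real_derivative
      c * ((t + E) powr (c - 1) * ln (t + E)) + (t + E) powr (c - 1)) (at t)" for c
  proof -
    have "((\<lambda>t. ln (t + E)) has_real_derivative 1 / (t + E)) (at t)"
      using pos by (auto intro!: derivative_eq_intros)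
    from DERIV_mult[OF DERIV_powr_shift[OF pos, of c] this] show ?thesis
      by (rule DERIV_cong) (use pos in \<open>simp add: powr_diff\<close>)
  qed
  show "((\<lambda>t. (t + E) powr b * ln (t + E)) has_real_derivative
      b * ((t + E) powr (b - 1) * ln (t + E)) + (t + E) powr (b - 1)) (at t)"
    by (rule D)
  show "((\<lambda>t. b * ((t + E) powr (b - 1) * ln (t + E)) + (t + E) powr (b - 1)) has_real_derivative
      b * (b - 1) * ((t + E) powr (b - 2) * ln (t + E)) + (2 * b - 1) * (t + E) powr (b - 2)) (at t)"
    by (rule DERIV_cong[OF DERIV_add[OF DERIV_cmult[OF D] DERIV_powr_shift[OF pos]]])
      (simp add: algebra_simps)
  have "(t + E) powr (b - 1) = (t + E) powr (b - 2) * (t + E)"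
    using pos by (simp add: powr_diff powr_numeral power2_eq_square)
  then show "4 * b * (b + (d / 2 - 1)) * ((t + E) powr (b - 1) * ln (t + E))
       + 4 * (2 * b + (d / 2 - 1)) * (t + E) powr (b - 1)
       + (- 4 * E * b * (b - 1) * ((t + E) powr (b - 2) * ln (t + E))
       + - 4 * E * (2 * b - 1) * (t + E) powr (b - 2)) =
      4 * t * (b * (b - 1) * ((t + E) powr (b - 2) * ln (t + E)) + (2 * b - 1) * (t + E) powr (b - 2))
      + 2 * d * (b * ((t + E) powr (b - 1) * ln (t + E)) + (t + E) powr (b - 1))"
    by (simp add: algebra_simps)
next
  show "continuous_on {0..} (\<lambda>t. b * (b - 1) * ((t + E) powr (b - 2) * ln (t + E)) + (2 * b - 1) * (t + E) powr (b - 2))"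
    using assms by (intro continuous_intros) auto
qed

lemma sum_shift_merge:
  fixes P Q X :: "nat \<Rightarrow> real"
  assumes "P (Suc m) = 0"
  shows "(\<Sum>j\<le>m. P j * X j + Q j * X (Suc j)) = (\<Sum>j\<le>Suc m. (P j + (if j = 0 then 0 else Q (j - 1))) * X j)"
proof -
  have "(\<Sum>j\<le>Suc m. (P j + (if j = 0 then 0 else Q (j - 1))) * X j) =
      (\<Sum>j\<le>Suc m. P j * X j) + (\<Sum>j\<le>Suc m. (if j = 0 then 0 else Q (j - 1)) * X j)"
    by (simp only: distrib_right sum.distrib)
  also have "(\<Sum>j\<le>Suc m. P j * X j) = (\<Sum>j\<le>m. P j * X j)" using assms by simp
  also have "(\<Sum>j\<le>Suc m. (if j = 0 then 0 else Q (j - 1)) * X j) = (\<Sum>j\<le>m. Q j * X (Suc j))"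
    by (subst sum.atMost_Suc_shift) simp
  finally show ?thesis by (simp add: sum.distrib)
qed

definition powr_iterate :: "real \<Rightarrow> real \<Rightarrow> real \<Rightarrow> nat \<Rightarrow> real \<Rightarrow> real" where
  "powr_iterate E \<beta> a m t = (\<Sum>j\<le>m. power_coeff E \<beta> m j a * (t + E) powr (a - real m - real j))"

text \<open>
  This is the derivative of \<open>powr_iterate E \<beta> a m t\<close> with respect to \<open>a\<close>. Since \<open>s\<^sup>a ln s\<close> is the
  derivative of \<open>s\<^sup>a\<close> with respect to \<open>a\<close>, and that derivative commutes with the Laplacian, it
  represents the iterated Laplacians of \<open>s\<^sup>a ln s\<close>.
\<close>

definition powr_ln_iterate :: "real \<Rightarrow> real \<Rightarrow> real \<Rightarrow> nat \<Rightarrow> real \<Rightarrow> real" where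
  "powr_ln_iterate E \<beta> a m t =
     (\<Sum>j\<le>m. deriv (power_coeff E \<beta> m j) a * (t + E) powr (a - real m - real j)
            + power_coeff E \<beta> m j a * ((t + E) powr (a - real m - real j) * ln (t + E)))"

lemma radial_laplacian_powr_iterate:
  assumes "E > 0"
  shows "radial_laplacian d (powr_iterate E (d / 2 - 1) a m) (powr_iterate E (d / 2 - 1) a (Suc m))"
proof -
  define \<beta> b c where "\<beta> = d / 2 - 1" and "b j = a - real m - real j"
    and "c j = power_coeff E \<beta> m j a" for j
  have "radial_laplacian d (\<lambda>t. \<Sum>j\<le>m. c j * (t + E) powr b j)
     (\<lambda>t. \<Sum>j\<le>m. c j * (4 * b j * (b j + \<beta>) * (t + E) powr (b j - 1)
        + - 4 * E * b j * (b j - 1) * (t + E) powr (b j - 2)))"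
    unfolding \<beta>_def
    by (intro radial_laplacian_sum radial_laplacian_cmult radial_laplacian_powr[OF assms]) simp
  then show ?thesis
    unfolding powr_iterate_def[abs_def] \<beta>_def[symmetric] c_def[symmetric] b_def[symmetric]
  proof (rule radial_laplacian_cong)
    fix t
    have e: "b j - 2 = b (Suc j) - 1" "a - real (Suc m) - real j = b j - 1" for j by (auto simp: b_def)
    have "(\<Sum>j\<le>m. c j * (4 * b j * (b j + \<beta>) * (t + E) powr (b j - 1)
        + - 4 * E * b j * (b j - 1) * (t + E) powr (b j - 2))) =
      (\<Sum>j\<le>m. (c j * (4 * b j * (b j + \<beta>))) * (t + E) powr (b j - 1)
        + (c j * (- 4 * E * b j * (b j - 1))) * (t + E) powr (b (Suc j) - 1))"
      unfolding e by (intro sum.cong refl) (simp add: algebra_simps)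
    also have "\<dots> = (\<Sum>j\<le>Suc m. (c j * (4 * b j * (b j + \<beta>))
        + (if j = 0 then 0 else c (j - 1) * (- 4 * E * b (j - 1) * (b (j - 1) - 1)))) * (t + E) powr (b j - 1))"
      by (rule sum_shift_merge) (simp add: c_def power_coeff_beyond)
    also have "\<dots> = (\<Sum>j\<le>Suc m. power_coeff E \<beta> (Suc m) j a * (t + E) powr (a - real (Suc m) - real j))"
      unfolding power_coeff_Suc e c_def b_def ..
    finally show "(\<Sum>j\<le>m. c j * (4 * b j * (b j + \<beta>) * (t + E) powr (b j - 1)
        + - 4 * E * b j * (b j - 1) * (t + E) powr (b j - 2))) = \<dots>" .
  qed
qed

lemma radial_laplacian_powr_ln_iterate:
  assumes "E > 0"
  shows "radial_laplacian d (powr_ln_iterate E (d / 2 - 1) a m) (powr_ln_iterate E (d / 2 - 1) a (Suc m))"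
proof -
  define \<beta> b c c' where "\<beta> = d / 2 - 1" and "b j = a - real m - real j"
    and "c j = power_coeff E \<beta> m j a" and "c' j = deriv (power_coeff E \<beta> m j) a" for j
  define X Y where "X t j = (t + E) powr (b j - 1)" and "Y t j = (t + E) powr (b j - 1) * ln (t + E)" for t j
  have beyond: "c (Suc m) = 0" "c' (Suc m) = 0"
  proof -
    have "power_coeff E \<beta> m (Suc m) = (\<lambda>a. 0)" by (auto simp: power_coeff_beyond)
    then show "c (Suc m) = 0" "c' (Suc m) = 0" by (auto simp: c_def c'_def)
  qed
  have "radial_laplacian d (\<lambda>t. \<Sum>j\<le>m. c' j * (t + E) powr b j + c j * ((t + E) powr b j * ln (t + E)))
     (\<lambda>t. \<Sum>j\<le>m. c' j * (4 * b j * (b j + \<beta>) * (t + E) powr (b j - 1)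
        + - 4 * E * b j * (b j - 1) * (t + E) powr (b j - 2))
       + c j * (4 * b j * (b j + \<beta>) * ((t + E) powr (b j - 1) * ln (t + E))
       + 4 * (2 * b j + \<beta>) * (t + E) powr (b j - 1)
       + (- 4 * E * b j * (b j - 1) * ((t + E) powr (b j - 2) * ln (t + E))
       + - 4 * E * (2 * b j - 1) * (t + E) powr (b j - 2))))"
    unfolding \<beta>_def
    by (intro radial_laplacian_sum radial_laplacian_add radial_laplacian_cmult
        radial_laplacian_powr[OF assms] radial_laplacian_powr_ln[OF assms]) simp
  then show ?thesis
    unfolding powr_ln_iterate_def[abs_def] \<beta>_def[symmetric] c_def[symmetric] c'_def[symmetric] b_def[symmetric]
  proof (rule radial_laplacian_cong)
    fix t
    have e: "b j - 2 = b (Suc j) - 1" "a - real (Suc m) - real j = b j - 1" for j by (auto simp: b_def)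
    have "(\<Sum>j\<le>m. c' j * (4 * b j * (b j + \<beta>) * (t + E) powr (b j - 1)
        + - 4 * E * b j * (b j - 1) * (t + E) powr (b j - 2))
       + c j * (4 * b j * (b j + \<beta>) * ((t + E) powr (b j - 1) * ln (t + E))
       + 4 * (2 * b j + \<beta>) * (t + E) powr (b j - 1)
       + (- 4 * E * b j * (b j - 1) * ((t + E) powr (b j - 2) * ln (t + E))
       + - 4 * E * (2 * b j - 1) * (t + E) powr (b j - 2)))) =
      (\<Sum>j\<le>m. ((c' j * (4 * b j * (b j + \<beta>)) + c j * (4 * (2 * b j + \<beta>))) * X t j
         + (c' j * (- 4 * E * b j * (b j - 1)) + c j * (- 4 * E * (2 * b j - 1))) * X t (Suc j))
       + ((c j * (4 * b j * (b j + \<beta>))) * Y t j + (c j * (- 4 * E * b j * (b j - 1))) * Y t (Suc j)))"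
      unfolding e
      unfolding Y_def[symmetric]
      unfolding X_def[symmetric] by (intro sum.cong refl) (simp add: algebra_simps)
    also have "\<dots> =
      (\<Sum>j\<le>Suc m. ((c' j * (4 * b j * (b j + \<beta>)) + c j * (4 * (2 * b j + \<beta>)))
         + (if j = 0 then 0 else c' (j - 1) * (- 4 * E * b (j - 1) * (b (j - 1) - 1))
             + c (j - 1) * (- 4 * E * (2 * b (j - 1) - 1)))) * X t j)
      + (\<Sum>j\<le>Suc m. (c j * (4 * b j * (b j + \<beta>))
        + (if j = 0 then 0 else c (j - 1) * (- 4 * E * b (j - 1) * (b (j - 1) - 1)))) * Y t j)"
      unfolding sum.distrib[where A = "{..m}" and g = "\<lambda>j. ((c' j * (4 * b j * (b j + \<beta>)) + c j * (4 * (2 * b j + \<beta>))) * X t j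
         + (c' j * (- 4 * E * b j * (b j - 1)) + c j * (- 4 * E * (2 * b j - 1))) * X t (Suc j))"]
      by (intro arg_cong2[of _ _ _ _ "(+)"] sum_shift_merge) (simp_all add: beyond)
    also have "\<dots> = (\<Sum>j\<le>Suc m. deriv (power_coeff E \<beta> (Suc m) j) a * (t + E) powr (a - real (Suc m) - real j)
            + power_coeff E \<beta> (Suc m) j a * ((t + E) powr (a - real (Suc m) - real j) * ln (t + E)))"
      unfolding power_coeff_Suc deriv_power_coeff_Suc e X_def Y_def sum.distrib[symmetric] c_def c'_def b_def ..
    finally show "(\<Sum>j\<le>m. c' j * (4 * b j * (b j + \<beta>) * (t + E) powr (b j - 1)
        + - 4 * E * b j * (b j - 1) * (t + E) powr (b j - 2))
       + c j * (4 * b j * (b j + \<beta>) * ((t + E) powr (b j - 1) * ln (t + E))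
       + 4 * (2 * b j + \<beta>) * (t + E) powr (b j - 1)
       + (- 4 * E * b j * (b j - 1) * ((t + E) powr (b j - 2) * ln (t + E))
       + - 4 * E * (2 * b j - 1) * (t + E) powr (b j - 2)))) = \<dots>" .
  qed
qed

text \<open>
  The polyharmonic spline as a function of \<open>s = r\<^sup>2\<close>; the factor \<open>1/2\<close> stems from \<open>ln r = ln (r\<^sup>2) / 2\<close>.
  At \<open>s = 0\<close> the conventions for \<open>powr\<close> give the value \<open>0\<close> in both cases.
\<close>

definition spline_profile :: "nat \<Rightarrow> nat \<Rightarrow> real \<Rightarrow> real" where
  "spline_profile d k s =
     (let a = real k - real d / 2 in if odd d then s powr a else s powr a * ln s / 2)"

lemma relpowp_sequence:
  assumes "\<forall>m. R (U m) (U (Suc m))"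
  shows "(R ^^ k) (U 0) (U k)"
  by (induction k) (use assms in \<open>auto intro: relpowp_Suc_I\<close>)

text \<open>
  All lower terms cancel. For odd \<open>d\<close> the exponent \<open>a = k - d/2\<close> is not an integer, so the remaining
  coefficient is a product of nonzero factors. For even \<open>d\<close> it is an integer between \<open>1\<close> and \<open>k - 1\<close>:
  then the coefficients with \<open>j < k\<close> have a double zero at \<open>a\<close>, so that their derivatives vanish as
  well, whereas the coefficient with \<open>j = k\<close> has a simple zero and thus a nonzero derivative.
\<close>

lemma regularised_spline_iterates:
  assumes "d < 2 * k" "d \<ge> 1"
  obtains C where "C \<noteq> 0" "\<And>E. E > 0 \<Longrightarrow>
     (radial_laplacian (real d) ^^ k) (\<lambda>t. spline_profile d k (t + E))
       (\<lambda>t. C * E ^ k * (t + E) powr (- real k - real d / 2))"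
proof (cases "odd d")
  case True
  define a \<beta> where "a = real k - real d / 2" and "\<beta> = real d / 2 - 1"
  have nonint: "a \<noteq> real i" for i
  proof
    assume "a = real i"
    then have "real (2 * k) = real (2 * i + d)" by (simp add: a_def)
    then have "2 * k = 2 * i + d" by linarith
    then show False using True by presburger
  qed
  show ?thesis
  proof (rule that)
    show "(- 4) ^ k * falling a (2 * k) \<noteq> 0" using falling_nonzero nonint by simp
    fix E :: real assume E: "E > 0"
    have ex: "a - real k - real k = - real k - real d / 2" by (simp add: a_def)
    have van: "power_coeff E \<beta> k j a = 0" if "j < k" for j
    proof -
      have "a + (\<beta> - real j) = real (k - 1 - j)" using that by (simp add: a_def \<beta>_def of_nat_diff)
      moreover have "falling (real (k - 1 - j)) (k - j) = 0" using that by (intro falling_eq_0) simp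
      ultimately show ?thesis by (simp add: power_coeff_def)
    qed
    have "powr_iterate E \<beta> a k = (\<lambda>t. (- 4) ^ k * falling a (2 * k) * E ^ k * (t + E) powr (- real k - real d / 2))"
    proof
      fix t
      have "powr_iterate E \<beta> a k t = (\<Sum>j\<in>{k}. power_coeff E \<beta> k j a * (t + E) powr (a - real k - real j))"
        unfolding powr_iterate_def by (intro sum.mono_neutral_right) (auto simp: van)
      also have "\<dots> = power_coeff E \<beta> k k a * (t + E) powr (- real k - real d / 2)"
        by (simp add: ex)
      also have "power_coeff E \<beta> k k a = (4 ^ k * (- E) ^ k) * falling a (2 * k)"
        by (simp add: power_coeff_def mult_2)
      also have "4 ^ k * (- E) ^ k = (- 4) ^ k * E ^ k"
        by (simp add: power_mult_distrib[symmetric])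
      finally show "powr_iterate E \<beta> a k t = (- 4) ^ k * falling a (2 * k) * E ^ k * (t + E) powr (- real k - real d / 2)"
        by (simp add: mult_ac)
    qed
    moreover have "powr_iterate E \<beta> a 0 = (\<lambda>t. spline_profile d k (t + E))"
      using True by (auto simp: powr_iterate_def power_coeff_def spline_profile_def a_def)
    moreover have "\<forall>m. radial_laplacian (real d) (powr_iterate E \<beta> a m) (powr_iterate E \<beta> a (Suc m))"
      unfolding \<beta>_def using radial_laplacian_powr_iterate[OF E] by blast
    ultimately show "(radial_laplacian (real d) ^^ k) (\<lambda>t. spline_profile d k (t + E))
       (\<lambda>t. ((- 4) ^ k * falling a (2 * k)) * E ^ k * (t + E) powr (- real k - real d / 2))"
      using relpowp_sequence[of "radial_laplacian (real d)" "powr_iterate E \<beta> a" k] by presburger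
  qed
next
  case False
  then obtain h where h: "d = 2 * h" by blast
  define p where "p = k - h"
  define a \<beta> where "a = real k - real d / 2" and "\<beta> = real d / 2 - 1"
  have a: "a = real p" using assms by (simp add: a_def h p_def of_nat_diff)
  have p: "p < k" using assms h by (auto simp: p_def)
  obtain D where D: "D \<noteq> 0" "((\<lambda>a. falling a (2 * k)) has_real_derivative D) (at a)"
    using falling_simple_root[of p "2 * k"] p a by auto
  show ?thesis
  proof (rule that)
    show "(- 4) ^ k * D / 2 \<noteq> 0" using D by simp
    fix E :: real assume E: "E > 0"
    have ex: "a - real k - real k = - real k - real d / 2" by (simp add: a_def)
    \<comment> \<open>Both falling factorials in the coefficient vanish at \<open>a\<close>, hence so does the derivative of their product.\<close>
    have van: "power_coeff E \<beta> k j a = 0" "deriv (power_coeff E \<beta> k j) a = 0" if "j < k" for j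
    proof -
      have sh: "a + (\<beta> - real j) = real (k - 1 - j)" using that by (simp add: a_def \<beta>_def of_nat_diff)
      have z2: "falling (a + (\<beta> - real j)) (k - j) = 0"
        unfolding sh using that by (intro falling_eq_0) simp
      have z1: "falling (a + 0) (k + j) = 0" using p by (simp add: a falling_eq_0)
      show "power_coeff E \<beta> k j a = 0" using z2 by (simp add: power_coeff_def)
      obtain D1 where D1: "((\<lambda>a. falling (a + 0) (k + j)) has_real_derivative D1) (at a)"
        using falling_differentiable by blast
      obtain D2 where D2: "((\<lambda>a. falling (a + (\<beta> - real j)) (k - j)) has_real_derivative D2) (at a)"
        using falling_differentiable by blast
      have "(power_coeff E \<beta> k j has_real_derivative 0) (at a)"
        using DERIV_cmult[OF DERIV_mult[OF D1 D2], of "4 ^ k * (- E) ^ j * real (k choose j)"]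
        unfolding power_coeff_def[abs_def] z1 z2 by (simp add: mult.assoc)
      then show "deriv (power_coeff E \<beta> k j) a = 0" by (rule DERIV_imp_deriv)
    qed
    have top: "power_coeff E \<beta> k k = (\<lambda>a. (- 4 * E) ^ k * falling a (2 * k))"
      by (simp add: power_coeff_def[abs_def] mult_2 power_mult_distrib[symmetric])
    have top0: "power_coeff E \<beta> k k a = 0"
      unfolding top using p by (simp add: a falling_eq_0)
    have top': "deriv (power_coeff E \<beta> k k) a = (- 4 * E) ^ k * D"
      unfolding top by (intro DERIV_imp_deriv DERIV_cmult D)
    have "(\<lambda>t. powr_ln_iterate E \<beta> a k t / 2) = (\<lambda>t. (- 4) ^ k * D / 2 * E ^ k * (t + E) powr (- real k - real d / 2))"
    proof
      fix t
      have "powr_ln_iterate E \<beta> a k t = (\<Sum>j\<in>{k}. deriv (power_coeff E \<beta> k j) a * (t + E) powr (a - real k - real j)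
            + power_coeff E \<beta> k j a * ((t + E) powr (a - real k - real j) * ln (t + E)))"
        unfolding powr_ln_iterate_def by (intro sum.mono_neutral_right) (auto simp: van)
      also have "\<dots> = (- 4 * E) ^ k * D * (t + E) powr (- real k - real d / 2)"
        by (simp add: top0 top' ex)
      also have "(- 4 * E) ^ k = (- 4) ^ k * E ^ k" by (rule power_mult_distrib)
      finally show "powr_ln_iterate E \<beta> a k t / 2 = (- 4) ^ k * D / 2 * E ^ k * (t + E) powr (- real k - real d / 2)"
        by simp
    qed
    moreover have "(\<lambda>t. powr_ln_iterate E \<beta> a 0 t / 2) = (\<lambda>t. spline_profile d k (t + E))"
      using False by (auto simp: powr_ln_iterate_def power_coeff_def[abs_def] spline_profile_def a_def)
    moreover have "\<forall>m. radial_laplacian (real d) (\<lambda>t. powr_ln_iterate E \<beta> a m t / 2) (\<lambda>t. powr_ln_iterate E \<beta> a (Suc m) t / 2)"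
      unfolding \<beta>_def using radial_laplacian_cmult[OF radial_laplacian_powr_ln_iterate[OF E], of _ "1 / 2"] by auto
    ultimately show "(radial_laplacian (real d) ^^ k) (\<lambda>t. spline_profile d k (t + E))
       (\<lambda>t. ((- 4) ^ k * D / 2) * E ^ k * (t + E) powr (- real k - real d / 2))"
      using relpowp_sequence[of "radial_laplacian (real d)" "\<lambda>m t. powr_ln_iterate E \<beta> a m t / 2" k] by presburger
  qed
qed

section \<open>Truncated powers as test functions\<close>

text \<open>
  At the origin the difference quotient is \<open>(max 0 z) ^ (n - 1)\<close>, whose continuity is Caratheodory's
  criterion for differentiability.
\<close>

lemma DERIV_truncated_power:
  assumes "n \<ge> 2"
  shows "((\<lambda>u. (max 0 u) ^ n) has_real_derivative real n * (max 0 u) ^ (n - 1)) (at u)"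
proof -
  consider "u > 0" | "u < 0" | "u = 0" by linarith
  then show ?thesis
  proof cases
    case 1
    have "((\<lambda>u. u ^ n) has_real_derivative real n * (max 0 u) ^ (n - 1)) (at u)"
      using 1 by (auto intro!: derivative_eq_intros)
    then show ?thesis
      by (rule has_field_derivative_transform_within_open[where S = "{0<..}"]) (use 1 in auto)
  next
    case 2
    have "((\<lambda>u. 0) has_real_derivative real n * (max 0 u) ^ (n - 1)) (at u)"
      using 2 assms by (auto intro!: derivative_eq_intros simp: zero_power)
    then show ?thesis
      by (rule has_field_derivative_transform_within_open[where S = "{..<0}"]) (use 2 assms in auto)
  next
    case 3
    define m where "m = n - 1"
    have m: "n = Suc m" "m > 0" using assms by (auto simp: m_def)
    have "isCont (\<lambda>z. (max 0 z) ^ m) (0::real)"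
      by (intro continuous_intros)
    then show ?thesis
      unfolding CARAT_DERIV 3 using m
      by (intro exI[of _ "\<lambda>z. (max 0 z) ^ m"]) (auto simp: max_def zero_power)
  qed
qed

definition bump :: "real \<Rightarrow> nat \<Rightarrow> real \<Rightarrow> real" where
  "bump r n t = (max 0 (r - t)) ^ n"

lemma bump_continuous: "continuous_on S (bump r n)"
  unfolding bump_def[abs_def] by (intro continuous_intros)

lemma bump_nonneg: "bump r n t \<ge> 0"
  by (simp add: bump_def)

lemma bump_le: "t \<ge> 0 \<Longrightarrow> r \<ge> 0 \<Longrightarrow> bump r n t \<le> r ^ n"
  unfolding bump_def by (intro power_mono) auto

lemma bump_zero: "t \<ge> r \<Longrightarrow> n > 0 \<Longrightarrow> bump r n t = 0"
  unfolding bump_def by (simp add: zero_power)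

lemma DERIV_bump:
  assumes "n \<ge> 2"
  shows "(bump r n has_real_derivative - real n * bump r (n - 1) t) (at t)"
proof -
  have "((\<lambda>t. r - t) has_real_derivative - 1) (at t)"
    by (auto intro!: derivative_eq_intros)
  from DERIV_chain2[OF DERIV_truncated_power[OF assms] this] show ?thesis
    by (simp add: bump_def[abs_def])
qed

lemma radial_laplacian_bump:
  "radial_laplacian d (bump r (n + 3))
     (\<lambda>t. (4 * r * (real n + 3) * (real n + 2)) * bump r (n + 1) t
        + (- 4 * (real n + 3) * (real n + 2) - 2 * d * (real n + 3)) * bump r (n + 2) t)"
  unfolding radial_laplacian_def
proof (intro exI conjI allI impI)
  fix t :: real
  show "(bump r (n + 3) has_real_derivative - (real n + 3) * bump r (n + 2) t) (at t)"
    using DERIV_bump[of "n + 3" r t] by (simp add: algebra_simps)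
  show "((\<lambda>t. - (real n + 3) * bump r (n + 2) t) has_real_derivative
      (real n + 3) * (real n + 2) * bump r (n + 1) t) (at t)"
    using DERIV_cmult[OF DERIV_bump[of "n + 2" r t], of "- (real n + 3)"] by (simp add: algebra_simps)
  have "t * bump r (n + 1) t = r * bump r (n + 1) t - bump r (n + 2) t"
    by (auto simp: bump_def max_def algebra_simps)
  then have "4 * t * ((real n + 3) * (real n + 2) * bump r (n + 1) t) =
      4 * (real n + 3) * (real n + 2) * (r * bump r (n + 1) t - bump r (n + 2) t)"
    by algebra
  then show "(4 * r * (real n + 3) * (real n + 2)) * bump r (n + 1) t
        + (- 4 * (real n + 3) * (real n + 2) - 2 * d * (real n + 3)) * bump r (n + 2) t =
      4 * t * ((real n + 3) * (real n + 2) * bump r (n + 1) t) + 2 * d * (- (real n + 3) * bump r (n + 2) t)"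
    by (simp add: algebra_simps)
qed (intro continuous_intros bump_continuous)

text \<open>
  Each Laplacian lowers the exponent of a truncated power by at most two, and exponent three is what
  a continuous second derivative in \<open>radial_laplacian_bump\<close> needs; so \<open>2k + 1\<close> suffices for \<open>k\<close>
  Laplacians.
\<close>

lemma bump_iterate:
  "n \<ge> 2 * k + 1 \<Longrightarrow> \<exists>B. (radial_laplacian d ^^ k) (bump r n) B \<and> continuous_on {0..} B"
proof (induction k arbitrary: n)
  case 0
  then show ?case using bump_continuous by auto
next
  case (Suc k)
  define m where "m = n - 3"
  have n: "n = m + 3" using Suc.prems by (simp add: m_def)
  obtain B1 where B1: "(radial_laplacian d ^^ k) (bump r (m + 1)) B1" "continuous_on {0..} B1"
    using Suc.IH[of "m + 1"] Suc.prems n by auto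
  obtain B2 where B2: "(radial_laplacian d ^^ k) (bump r (m + 2)) B2" "continuous_on {0..} B2"
    using Suc.IH[of "m + 2"] Suc.prems n by auto
  let ?\<alpha> = "4 * r * (real m + 3) * (real m + 2)"
    and ?\<gamma> = "- 4 * (real m + 3) * (real m + 2) - 2 * d * (real m + 3)"
  have "(radial_laplacian d ^^ k) (\<lambda>t. ?\<alpha> * bump r (m + 1) t + ?\<gamma> * bump r (m + 2) t)
      (\<lambda>t. ?\<alpha> * B1 t + ?\<gamma> * B2 t)"
    by (intro radial_laplacian_power_add radial_laplacian_power_cmult B1 B2)
  then have "(radial_laplacian d ^^ Suc k) (bump r n) (\<lambda>t. ?\<alpha> * B1 t + ?\<gamma> * B2 t)"
    unfolding n by (rule relpowp_Suc_I2[where P = "radial_laplacian d", OF radial_laplacian_bump])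
  moreover have "continuous_on {0..} (\<lambda>t. ?\<alpha> * B1 t + ?\<gamma> * B2 t)"
    by (intro continuous_intros B1 B2)
  ultimately show ?case by blast
qed

section \<open>The spline as a fundamental solution\<close>

lemma spline_profile_continuous:
  assumes "d < 2 * k"
  shows "continuous_on {0..} (spline_profile d k)"
proof -
  define a where "a = real k - real d / 2"
  have "a > 0" using assms by (simp add: a_def)
  have 1: "continuous_on {0..} (\<lambda>s. s powr a)"
    using \<open>a > 0\<close> by (intro continuous_on_powr') (auto intro!: continuous_intros)
  have 2: "continuous_on {0..} (\<lambda>s. s powr a * ln s)"
    unfolding continuous_on_eq_continuous_within
  proof
    fix s :: real assume "s \<in> {0..}"
    show "continuous (at s within {0..}) (\<lambda>s. s powr a * ln s)"
    proof (cases "s = 0")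
      case True
      have "((\<lambda>s. s powr a * ln s) \<longlongrightarrow> 0) (at_right 0)"
        using \<open>a > 0\<close> by real_asymp
      moreover have "at (0::real) within {0..} = at_right 0"
        by (simp add: at_within_Ici_at_right)
      ultimately show ?thesis
        unfolding True continuous_within by simp
    next
      case False
      then have "isCont (\<lambda>s. s powr a * ln s) s"
        using \<open>s \<in> {0..}\<close> by (intro continuous_intros) auto
      then show ?thesis by (rule continuous_at_imp_continuous_at_within)
    qed
  qed
  show ?thesis
    unfolding spline_profile_def[abs_def] Let_def a_def[symmetric]
    using 1 2 by (cases "odd d") (auto intro!: continuous_intros)
qed

lemma integral_affine_substitution:
  fixes g :: "'a::euclidean_space \<Rightarrow> real"
  assumes "g \<in> borel_measurable borel" "e > 0"
  shows "(\<integral>y. g y \<partial>lborel) = e ^ DIM('a) * (\<integral>u. g (x + e *\<^sub>R u) \<partial>lborel)"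
proof -
  have "(\<integral>y. g y \<partial>lborel) = (\<integral>y. g y \<partial>density (distr lborel borel (\<lambda>u. x + e *\<^sub>R u)) (\<lambda>_. ennreal (e ^ DIM('a))))"
    using lborel_affine[of e x] assms by simp
  also have "\<dots> = (\<integral>u. e ^ DIM('a) * g (x + e *\<^sub>R u) \<partial>lborel)"
    using assms by (simp add: integral_density integral_distr)
  finally show ?thesis by simp
qed

lemma scaling_exponent:
  assumes "e > 0"
  shows "e ^ d * ((e\<^sup>2) ^ k * (e\<^sup>2) powr (- real k - real d / 2)) = (1::real)"
proof -
  let ?b = "- real k - real d / 2"
  have 1: "e ^ d = e powr real d" using powr_realpow[OF assms] by simp
  have 2: "(e\<^sup>2) ^ k = e powr real (2 * k)"
    unfolding powr_realpow[OF assms] by (simp only: power_mult)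
  have "e\<^sup>2 = e powr 2" using assms by simp
  then have 3: "(e\<^sup>2) powr ?b = e powr (2 * ?b)" by (simp only: powr_powr)
  have "e powr real d * (e powr real (2 * k) * e powr (2 * ?b)) =
      e powr (real d + (real (2 * k) + 2 * ?b))"
    by (simp only: powr_add)
  also have "real d + (real (2 * k) + 2 * ?b) = 0" by simp
  finally show ?thesis unfolding 1 2 3 using assms by simp
qed

text \<open>
  Green's identity moves the Laplacians from the bump to the regularised spline. The result is \<open>C\<close>
  times the average of the bump under the rescaled kernel \<open>K\<close>, and rescaling the variable of
  integration turns it into \<open>C \<integral> K(u) h(x + \<epsilon> u) du\<close>. As \<open>\<epsilon> \<rightarrow> 0\<close> this tends to \<open>C (\<integral> K) h(x)\<close>.
\<close>

lemma spline_reproduces_bump: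
  assumes k: "DIM('a::euclidean_space) < 2 * k" and r: "r > 0"
  shows "\<exists>c B. continuous_on {0..} B \<and> (\<forall>t>r. B t = 0) \<and>
    (\<forall>x z :: 'a. bump r (2 * k + 1) ((norm (x - z))\<^sup>2) =
       c * (\<integral>y. spline_profile DIM('a) k ((norm (y - x))\<^sup>2) * B ((norm (y - z))\<^sup>2) \<partial>lborel))"
proof -
  define d b n where "d = DIM('a)" and "b = - real k - real d / 2" and "n = 2 * k + 1"
  have d: "d < 2 * k" "d \<ge> 1" using k by (auto simp: d_def Suc_leI)
  obtain C where "C \<noteq> 0" and C: "\<And>E. E > 0 \<Longrightarrow>
     (radial_laplacian (real d) ^^ k) (\<lambda>t. spline_profile d k (t + E)) (\<lambda>t. C * E ^ k * (t + E) powr b)"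
    using regularised_spline_iterates[OF d] unfolding b_def by metis
  obtain B where B: "(radial_laplacian (real d) ^^ k) (bump r n) B" and Bc: "continuous_on {0..} B"
    using bump_iterate[of k n] unfolding n_def by blast
  have suppb: "bump r n t = 0" if "t > r" for t using that by (intro bump_zero) (auto simp: n_def)
  have suppB: "B t = 0" if "t > r" for t
    using radial_laplacian_power_support[OF B suppb _ that] r by simp
  define q :: "'a \<Rightarrow> 'a \<Rightarrow> real" where "q c y = (norm (y - c))\<^sup>2" for c y
  have q0: "q c y \<ge> 0" for c y by (simp add: q_def)
  have cq: "continuous_on UNIV (\<lambda>y. f (q c y))" if "continuous_on {0..} f" for f :: "real \<Rightarrow> real" and c
    unfolding q_def by (rule continuous_on_compose2[OF that]) (auto intro!: continuous_intros)
  have outside: "q z y > r" if "y \<notin> cball z (sqrt r)" for z y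
  proof -
    have "sqrt r < norm (y - z)" using that by (simp add: dist_norm norm_minus_commute)
    then have "(sqrt r)\<^sup>2 < (norm (y - z))\<^sup>2" using r by (intro power_strict_mono) auto
    then show ?thesis using r by (simp add: q_def)
  qed
  define K :: "'a \<Rightarrow> real" where "K u = (1 + (norm u)\<^sup>2) powr b" for u
  have one: "1 + (norm u)\<^sup>2 \<noteq> 0" for u :: 'a
    by (smt (verit) zero_le_power2)
  have Kpos: "K u > 0" for u
    unfolding K_def using one by simp
  have Kc: "continuous_on UNIV K"
    unfolding K_def by (intro continuous_intros) (use one in auto)
  have Km [measurable]: "K \<in> borel_measurable borel"
    by (rule borel_measurable_continuous_onI[OF Kc])
  define e where "e m = inverse (real (Suc m))" for m
  have e: "e m > 0" "e m \<le> 1" for m by (auto simp: e_def inverse_le_1_iff)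
  have e0: "e \<longlonglongrightarrow> 0" unfolding e_def by (rule LIMSEQ_inverse_real_of_nat)
  define J where "J x z m = (\<integral>y. spline_profile d k (q x y + (e m)\<^sup>2) * B (q z y) \<partial>lborel)" for x z m
  define J0 where "J0 x z = (\<integral>y. spline_profile d k (q x y) * B (q z y) \<partial>lborel)" for x z
  define h where "h x z m u = K u * bump r n (q z (x + e m *\<^sub>R u))" for x z m u
  have pc: "continuous_on {0..} (spline_profile d k)" by (rule spline_profile_continuous[OF d(1)])
  have cbump: "continuous_on UNIV (\<lambda>u. bump r n (q z (x + e m *\<^sub>R u)))" for x z m
    by (rule continuous_on_compose2[OF cq[OF bump_continuous]]) (auto intro!: continuous_intros)
  have hm: "h x z m \<in> borel_measurable borel" for x z m
    unfolding h_def[abs_def] by (intro borel_measurable_continuous_onI continuous_intros Kc cbump)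
  have hi: "integrable lborel (h x z m)" for x z m
  proof (rule integrable_continuous_bounded_support)
    show "continuous_on UNIV (h x z m)"
      unfolding h_def by (intro continuous_intros Kc cbump)
    fix u assume u: "u \<notin> cball ((z - x) /\<^sub>R e m) (sqrt r / e m)"
    have "x + e m *\<^sub>R u \<notin> cball z (sqrt r)"
    proof
      assume "x + e m *\<^sub>R u \<in> cball z (sqrt r)"
      then have "norm (z - (x + e m *\<^sub>R u)) \<le> sqrt r" by (simp add: dist_norm)
      moreover have "z - (x + e m *\<^sub>R u) = e m *\<^sub>R ((z - x) /\<^sub>R e m - u)"
        using e(1)[of m] by (simp add: algebra_simps)
      ultimately have "e m * norm ((z - x) /\<^sub>R e m - u) \<le> sqrt r"
        using e(1)[of m] by simp
      then have "norm ((z - x) /\<^sub>R e m - u) \<le> sqrt r / e m"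
        using e(1)[of m] by (simp add: pos_le_divide_eq mult.commute)
      then show False using u by (simp add: dist_norm)
    qed
    then show "h x z m u = 0" using suppb[OF outside] by (simp add: h_def)
  qed
  have J: "J x z m = C * (\<integral>u. h x z m u \<partial>lborel)" for x z m
  proof -
    have "J x z m = (\<integral>y. C * (e m)\<^sup>2 ^ k * (q x y + (e m)\<^sup>2) powr b * bump r n (q z y) \<partial>lborel)"
      unfolding J_def q_def
      by (rule radial_green_iterated[where 'a = 'a, folded d_def, OF C B suppb])
        (use e(1)[of m] r in auto)
    also have "\<dots> = (e m) ^ DIM('a) * (\<integral>u. C * (e m)\<^sup>2 ^ k * (q x (x + e m *\<^sub>R u) + (e m)\<^sup>2) powr b
        * bump r n (q z (x + e m *\<^sub>R u)) \<partial>lborel)"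
    proof (rule integral_affine_substitution)
      have cp: "continuous_on {0..} (\<lambda>t. (t + (e m)\<^sup>2) powr b)"
        using e(1)[of m] by (intro continuous_intros) (auto simp: add_nonneg_eq_0_iff)
      show "(\<lambda>y. C * (e m)\<^sup>2 ^ k * (q x y + (e m)\<^sup>2) powr b * bump r n (q z y)) \<in> borel_measurable borel"
        by (intro borel_measurable_continuous_onI continuous_on_mult continuous_on_const
            cq[OF cp] cq[OF bump_continuous])
    qed (rule e)
    also have "\<dots> = (\<integral>u. C * h x z m u \<partial>lborel)"
    proof -
      have "(e m) ^ d * ((e m)\<^sup>2 ^ k * (q x (x + e m *\<^sub>R u) + (e m)\<^sup>2) powr b) = K u" for u
      proof -
        have pos: "1 + (norm u)\<^sup>2 > 0" by (simp add: add_pos_nonneg)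
        have "q x (x + e m *\<^sub>R u) + (e m)\<^sup>2 = (e m)\<^sup>2 * (1 + (norm u)\<^sup>2)"
          by (simp add: q_def power_mult_distrib algebra_simps)
        then have "(q x (x + e m *\<^sub>R u) + (e m)\<^sup>2) powr b = (e m)\<^sup>2 powr b * K u"
          using pos unfolding K_def by (simp add: powr_mult)
        moreover have "(e m) ^ d * ((e m)\<^sup>2 ^ k * (e m)\<^sup>2 powr b) = 1"
          using scaling_exponent[OF e(1)] by (simp add: b_def)
        ultimately show ?thesis by (metis mult.assoc mult_1)
      qed
      note K_eq = this
      have pointwise: "(e m) ^ d * (C * (e m)\<^sup>2 ^ k * (q x (x + e m *\<^sub>R u) + (e m)\<^sup>2) powr b * bump r n (q z (x + e m *\<^sub>R u)))
          = C * h x z m u" for u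
      proof -
        have "(e m) ^ d * (C * (e m)\<^sup>2 ^ k * (q x (x + e m *\<^sub>R u) + (e m)\<^sup>2) powr b * bump r n (q z (x + e m *\<^sub>R u)))
          = C * (((e m) ^ d * ((e m)\<^sup>2 ^ k * (q x (x + e m *\<^sub>R u) + (e m)\<^sup>2) powr b)) * bump r n (q z (x + e m *\<^sub>R u)))"
          by (simp only: mult.assoc mult.left_commute)
        then show ?thesis unfolding K_eq h_def .
      qed
      show ?thesis unfolding d_def[symmetric]
        by (simp only: integral_mult_right_zero[symmetric] pointwise)
    qed
    finally show ?thesis by simp
  qed
  have Jlim: "J x z \<longlonglongrightarrow> J0 x z" for x z
  proof -
    have comp: "compact ((\<lambda>(y, s). q x y + s) ` (cball z (sqrt r) \<times> {0..1}))"
      unfolding q_def case_prod_beta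
      by (intro compact_continuous_image compact_Times continuous_intros) auto
    have sub: "(\<lambda>(y, s). q x y + s) ` (cball z (sqrt r) \<times> {0..1}) \<subseteq> {0..}"
      using q0 by auto
    have "bounded (spline_profile d k ` ((\<lambda>(y, s). q x y + s) ` (cball z (sqrt r) \<times> {0..1})))"
      by (rule compact_imp_bounded[OF compact_continuous_image[OF continuous_on_subset[OF pc sub] comp]])
    then obtain M where M: "\<And>y s. y \<in> cball z (sqrt r) \<Longrightarrow> s \<in> {0..1} \<Longrightarrow> \<bar>spline_profile d k (q x y + s)\<bar> \<le> M"
      unfolding bounded_iff by fastforce
    show ?thesis
      unfolding J_def[abs_def] J0_def
    proof (rule integral_dominated_convergence[where w = "\<lambda>y. M * \<bar>B (q z y)\<bar>"])
      have meas: "(\<lambda>y. spline_profile d k (q x y + s) * B (q z y)) \<in> borel_measurable borel" if "s \<ge> 0" for s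
      proof -
        have cp: "continuous_on {0..} (\<lambda>t. spline_profile d k (t + s))"
          using that by (intro continuous_on_compose2[OF pc]) (auto intro!: continuous_intros)
        show ?thesis
          by (intro borel_measurable_continuous_onI continuous_on_mult cq[OF cp] cq[OF Bc])
      qed
      show "(\<lambda>y. spline_profile d k (q x y) * B (q z y)) \<in> borel_measurable lborel"
        using meas[of 0] by simp
      show "(\<lambda>y. spline_profile d k (q x y + (e m)\<^sup>2) * B (q z y)) \<in> borel_measurable lborel" for m
        using meas by simp
      show "integrable lborel (\<lambda>y. M * \<bar>B (q z y)\<bar>)"
        by (rule integrable_continuous_bounded_support[of _ z "sqrt r"])
          (use outside in \<open>auto intro!: continuous_intros cq Bc suppB\<close>)
      show "AE y in lborel. (\<lambda>m. spline_profile d k (q x y + (e m)\<^sup>2) * B (q z y)) \<longlonglongrightarrow> spline_profile d k (q x y) * B (q z y)"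
      proof (rule AE_I2)
        fix y
        have "(\<lambda>m. q x y + (e m)\<^sup>2) \<longlonglongrightarrow> q x y + 0\<^sup>2"
          by (intro tendsto_intros e0)
        then have "(\<lambda>m. spline_profile d k (q x y + (e m)\<^sup>2)) \<longlonglongrightarrow> spline_profile d k (q x y)"
          by (intro continuous_on_tendsto_compose[OF pc]) (use q0 in auto)
        then show "(\<lambda>m. spline_profile d k (q x y + (e m)\<^sup>2) * B (q z y)) \<longlonglongrightarrow> spline_profile d k (q x y) * B (q z y)"
          by (intro tendsto_intros)
      qed
      show "AE y in lborel. norm (spline_profile d k (q x y + (e m)\<^sup>2) * B (q z y)) \<le> M * \<bar>B (q z y)\<bar>" for m
      proof (rule AE_I2)
        fix y
        show "norm (spline_profile d k (q x y + (e m)\<^sup>2) * B (q z y)) \<le> M * \<bar>B (q z y)\<bar>"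
        proof (cases "y \<in> cball z (sqrt r)")
          case True
          have "(e m)\<^sup>2 \<in> {0..1}" using e[of m] by (auto simp: power_le_one)
          from M[OF True this] show ?thesis by (auto simp: abs_mult intro: mult_right_mono)
        qed (use suppB[OF outside] in simp)
      qed
    qed
  qed
  have hlim: "(\<lambda>m. h x z m u) \<longlonglongrightarrow> K u * bump r n (q z x)" for x z u
  proof -
    have "(\<lambda>m. x + e m *\<^sub>R u) \<longlonglongrightarrow> x + 0 *\<^sub>R u" by (intro tendsto_intros e0)
    then have "(\<lambda>m. bump r n (q z (x + e m *\<^sub>R u))) \<longlonglongrightarrow> bump r n (q z x)"
      by (intro continuous_on_tendsto_compose[OF cq[OF bump_continuous]]) auto
    then show ?thesis unfolding h_def by (intro tendsto_intros)
  qed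
  have hbound: "norm (h x z m u) \<le> K u * r ^ n" for x z m u
    unfolding h_def using Kpos[of u] bump_nonneg bump_le[OF q0, of r n] r
    by (auto simp: abs_mult intro!: mult_left_mono)
  have hnn: "h x z m u \<ge> 0" for x z m u
    unfolding h_def using Kpos[of u] bump_nonneg by simp
  \<comment> \<open>The averages of the bump around its centre converge by \<open>Jlim\<close>, hence Fatou's lemma bounds the
    integral of \<open>K\<close>; this spares an estimate of \<open>K\<close> at infinity.\<close>
  have Ki: "integrable lborel K"
  proof -
    have lim: "(\<lambda>m. \<integral>u. h 0 0 m u \<partial>lborel) \<longlonglongrightarrow> J0 0 0 / C"
      using tendsto_divide[OF Jlim[of 0 0] tendsto_const \<open>C \<noteq> 0\<close>] \<open>C \<noteq> 0\<close> unfolding J by simp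
    have "(\<integral>\<^sup>+u. ennreal (K u * r ^ n) \<partial>lborel) = (\<integral>\<^sup>+u. liminf (\<lambda>m. ennreal (h 0 0 m u)) \<partial>lborel)"
    proof (intro nn_integral_cong)
      fix u :: 'a
      have "bump r n (q 0 0) = r ^ n" using r by (simp add: bump_def q_def)
      with hlim[of 0 0 u] have "(\<lambda>m. ennreal (h 0 0 m u)) \<longlonglongrightarrow> ennreal (K u * r ^ n)"
        by (intro tendsto_ennrealI) simp
      then show "ennreal (K u * r ^ n) = liminf (\<lambda>m. ennreal (h 0 0 m u))"
        by (intro lim_imp_Liminf[symmetric]) auto
    qed
    also have "\<dots> \<le> liminf (\<lambda>m. \<integral>\<^sup>+u. ennreal (h 0 0 m u) \<partial>lborel)"
      by (intro nn_integral_liminf) (use hm in simp)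
    also have "\<dots> = liminf (\<lambda>m. ennreal (\<integral>u. h 0 0 m u \<partial>lborel))"
      using hi hnn by (simp add: nn_integral_eq_integral)
    also have "\<dots> = ennreal (J0 0 0 / C)"
      by (intro lim_imp_Liminf tendsto_ennrealI lim) auto
    finally have "(\<integral>\<^sup>+u. ennreal (K u * r ^ n) \<partial>lborel) < \<infinity>"
      using ennreal_less_top order_le_less_trans by (metis infinity_ennreal_def)
    then have "integrable lborel (\<lambda>u. K u * r ^ n)"
      by (intro integrableI_nonneg) (use Kpos r in \<open>auto intro!: less_imp_le\<close>)
    then show ?thesis using r by simp
  qed
  define I where "I = (\<integral>u. K u \<partial>lborel)"
  have "I \<noteq> 0"
  proof
    assume "I = 0"
    then have "AE u in lborel. K u = 0"
      unfolding I_def using integral_nonneg_eq_0_iff_AE[OF Ki] Kpos by (simp add: less_imp_le)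
    then have "AE u in (lborel :: 'a measure). False"
      using Kpos by (auto elim!: eventually_mono simp: less_le)
    then show False by (simp add: ae_filter_eq_bot_iff eventually_False)
  qed
  have final: "J0 x z = C * I * bump r n (q z x)" for x z
  proof -
    have "(\<lambda>m. \<integral>u. h x z m u \<partial>lborel) \<longlonglongrightarrow> (\<integral>u. K u * bump r n (q z x) \<partial>lborel)"
      by (rule integral_dominated_convergence[where w = "\<lambda>u. K u * r ^ n"])
        (use hm hlim hbound Ki in auto)
    then have "J x z \<longlonglongrightarrow> C * (I * bump r n (q z x))"
      unfolding J I_def by (intro tendsto_intros) simp
    with Jlim[of x z] show ?thesis by (simp add: LIMSEQ_unique mult.assoc)
  qed
  show ?thesis
  proof (intro exI[of _ "1 / (C * I)"] exI[of _ B] conjI allI impI)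
    fix x z :: 'a
    show "bump r (2 * k + 1) ((norm (x - z))\<^sup>2) =
       1 / (C * I) * (\<integral>y. spline_profile DIM('a) k ((norm (y - x))\<^sup>2) * B ((norm (y - z))\<^sup>2) \<partial>lborel)"
      using final[of x z] \<open>C \<noteq> 0\<close> \<open>I \<noteq> 0\<close> unfolding J0_def q_def n_def d_def by simp
  qed (use Bc suppB in auto)
qed

section \<open>Approximation of functions supported in the interior\<close>

lemma polyharmonic_spline_eq_profile:
  assumes "d < 2 * k" "r \<ge> 0"
  shows "polyharmonic_spline d k r = spline_profile d k (r\<^sup>2)"
proof (cases "r = 0")
  case True
  then show ?thesis using assms by (simp add: polyharmonic_spline_def spline_profile_def)
next
  case False
  define a where "a = real k - real d / 2"
  from False assms have r: "r > 0" by simp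
  have "r\<^sup>2 = r powr 2" using r by simp
  then have "(r\<^sup>2) powr a = r powr (2 * a)" by (simp only: powr_powr)
  also have "2 * a = real (2 * k - d)" using assms by (simp add: a_def of_nat_diff)
  also have "r powr \<dots> = r ^ (2 * k - d)" by (rule powr_realpow[OF r])
  finally show ?thesis
    using r by (simp add: polyharmonic_spline_def spline_profile_def a_def[symmetric] ln_realpow)
qed

lemma polyharmonic_kernel_continuous:
  assumes "d < 2 * k"
  shows "continuous_on UNIV (\<lambda>(x, y). polyharmonic_spline d k (norm (x - y :: 'a::euclidean_space)))"
proof -
  have "continuous_on UNIV (\<lambda>p :: 'a \<times> 'a. spline_profile d k ((norm (fst p - snd p))\<^sup>2))"
    by (rule continuous_on_compose2[OF spline_profile_continuous[OF assms]])
      (auto intro!: continuous_intros)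
  then show ?thesis
    by (simp add: polyharmonic_spline_eq_profile[OF assms] case_prod_beta)
qed

text \<open>
  The Riemann sums of the integral that represents the bump have their nodes in its support.
\<close>

lemma approximable_bump:
  fixes z :: "'a::euclidean_space"
  assumes d: "DIM('a) < 2 * k" and K: "compact K" and \<rho>: "\<rho> > 0" and S: "cball z \<rho> \<subseteq> S"
  shows "approximable K S (\<lambda>x y. polyharmonic_spline DIM('a) k (norm (x - y)))
           (\<lambda>x. bump (\<rho>\<^sup>2) (2 * k + 1) ((norm (x - z))\<^sup>2))"
proof -
  let ?F = "\<lambda>x y :: 'a. polyharmonic_spline DIM('a) k (norm (x - y))"
  have "\<rho>\<^sup>2 > 0" using \<rho> by simp
  from spline_reproduces_bump[where 'a = 'a, OF d this]
  obtain c B where B: "continuous_on {0..} B" "\<forall>t>\<rho>\<^sup>2. B t = 0"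
    and eq: "\<forall>x z :: 'a. bump (\<rho>\<^sup>2) (2 * k + 1) ((norm (x - z))\<^sup>2) =
       c * (\<integral>y. spline_profile DIM('a) k ((norm (y - x))\<^sup>2) * B ((norm (y - z))\<^sup>2) \<partial>lborel)"
    by (elim exE conjE) iprover
  have supp: "B ((norm (y - z))\<^sup>2) = 0" if "y \<notin> cball z \<rho>" for y
  proof (rule B(2)[rule_format])
    have "\<rho> < norm (y - z)" using that by (simp add: dist_norm norm_minus_commute)
    then show "\<rho>\<^sup>2 < (norm (y - z))\<^sup>2" using \<rho> by (intro power_strict_mono) auto
  qed
  have cont: "continuous_on UNIV (\<lambda>y. B ((norm (y - z))\<^sup>2))"
    by (rule continuous_on_compose2[OF B(1)]) (auto intro!: continuous_intros)
  have "approximable K (cball z \<rho>) ?F (\<lambda>x. \<integral>y. ?F x y * B ((norm (y - z))\<^sup>2) \<partial>lborel)"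
    by (rule approximable_integral[OF K compact_cball polyharmonic_kernel_continuous[OF d]
          integrable_continuous_bounded_support[OF cont supp] supp])
  then have "approximable K S ?F (\<lambda>x. c * (\<integral>y. ?F x y * B ((norm (y - z))\<^sup>2) \<partial>lborel))"
    using approximable_mono[OF _ S] approximable_cmult by blast
  moreover have "?F x y = spline_profile DIM('a) k ((norm (y - x))\<^sup>2)" for x y
    by (simp add: polyharmonic_spline_eq_profile[OF d] norm_minus_commute)
  ultimately show ?thesis by (simp only: eq[rule_format])
qed

text \<open>
  Averaging \<open>g\<close> with a normalised bump of small radius \<open>\<rho>\<close> changes it little, and the average is an
  integral of bumps with centres in \<open>S\<close>. Their supports lie in \<open>\<Omega>\<close> when \<open>\<rho>\<close> is smaller than the
  distance of \<open>S\<close> to the complement of the interior.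
\<close>

lemma approximable_compact_support:
  fixes g :: "'a::euclidean_space \<Rightarrow> real"
  assumes d: "DIM('a) < 2 * k" and \<Omega>: "compact \<Omega>" and S: "compact S" "S \<subseteq> interior \<Omega>"
    and g: "continuous_on UNIV g" and supp: "\<And>x. x \<notin> S \<Longrightarrow> g x = 0"
  shows "approximable \<Omega> \<Omega> (\<lambda>x y. polyharmonic_spline DIM('a) k (norm (x - y))) g"
proof (rule approximable_uniform_limit)
  fix e :: real assume "e > 0"
  let ?F = "\<lambda>x y :: 'a. polyharmonic_spline DIM('a) k (norm (x - y))"
  obtain \<rho>1 where \<rho>1: "\<rho>1 > 0" "(\<Union>z\<in>S. cball z \<rho>1) \<subseteq> interior \<Omega>"
    using compact_subset_open_imp_cball_epsilon_subset[OF S(1) open_interior S(2)] by blast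
  \<comment> \<open>A compact neighbourhood of \<open>\<Omega>\<close>, as the points \<open>z\<close> near \<open>x \<in> \<Omega>\<close> may lie outside \<open>\<Omega>\<close>.\<close>
  define T where "T = {x + y | x y. x \<in> \<Omega> \<and> y \<in> cball (0::'a) 1}"
  have "compact T" unfolding T_def by (intro compact_sums \<Omega> compact_cball)
  then have "uniformly_continuous_on T g"
    by (intro compact_uniformly_continuous continuous_on_subset[OF g]) auto
  then obtain \<rho>2 where "\<rho>2 > 0"
    and \<rho>2: "\<And>x z. x \<in> T \<Longrightarrow> z \<in> T \<Longrightarrow> dist z x < \<rho>2 \<Longrightarrow> dist (g z) (g x) < e"
    unfolding uniformly_continuous_on_def using \<open>e > 0\<close> by metis
  define \<rho> where "\<rho> = min \<rho>1 (min (\<rho>2 / 2) 1)"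
  have \<rho>: "\<rho> > 0" "\<rho> \<le> \<rho>1" "\<rho> < \<rho>2" "\<rho> \<le> 1"
    using \<rho>1(1) \<open>\<rho>2 > 0\<close> by (auto simp: \<rho>_def)
  have near: "\<bar>g z - g x\<bar> \<le> e" if "x \<in> \<Omega>" "norm (z - x) \<le> \<rho>" for x z
  proof -
    have "x \<in> T" unfolding T_def using that(1) by (intro CollectI exI[of _ x] exI[of _ 0]) auto
    moreover have "z \<in> T"
      unfolding T_def using that \<rho> by (intro CollectI exI[of _ x] exI[of _ "z - x"]) auto
    ultimately show ?thesis
      using \<rho>2[of x z] that \<rho> by (simp add: dist_norm)
  qed
  define n where "n = 2 * k + 1"
  define G where "G x z = bump (\<rho>\<^sup>2) n ((norm (x - z))\<^sup>2)" for x z :: 'a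
  have G0: "G x z \<ge> 0" for x z by (simp add: G_def bump_nonneg)
  have Gsupp: "G x z = 0" if "norm (z - x) > \<rho>" for x z
  proof -
    have "\<rho>\<^sup>2 \<le> (norm (x - z))\<^sup>2"
      using that \<rho>(1) by (intro power_mono) (auto simp: norm_minus_commute)
    then show ?thesis unfolding G_def by (rule bump_zero) (simp add: n_def)
  qed
  have Gc: "continuous_on UNIV (\<lambda>(x, z). G x z)"
    unfolding G_def case_prod_beta
    by (rule continuous_on_compose2[OF bump_continuous[of UNIV]]) (auto intro!: continuous_intros)
  have Gcx: "continuous_on UNIV (G x)" for x
    unfolding G_def
    by (rule continuous_on_compose2[OF bump_continuous[of UNIV]]) (auto intro!: continuous_intros)
  have Gi: "integrable lborel (G x)" for x
    by (rule integrable_continuous_bounded_support[OF Gcx, of x \<rho>])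
      (auto intro!: Gsupp simp: dist_norm norm_minus_commute)
  define I where "I = (\<integral>z. G 0 z \<partial>lborel)"
  have I: "(\<integral>z. G x z \<partial>lborel) = I" for x
    using lborel_integral_translate[OF borel_measurable_continuous_onI[OF Gcx[of 0]], of "- x"]
    unfolding I_def by (simp add: G_def[abs_def] norm_minus_commute)
  have "I > 0"
  proof -
    \<comment> \<open>On the ball of half the radius the bump is at least \<open>(\<rho>\<^sup>2 - (\<rho>/2)\<^sup>2) ^ n = (3/4 \<rho>\<^sup>2) ^ n\<close>.\<close>
    have "0 < (3 / 4 * \<rho>\<^sup>2) ^ n * measure lborel (ball (0::'a) (\<rho> / 2))"
      using \<rho>(1) content_ball_pos[of "\<rho> / 2" "0::'a"] by simp
    also have "\<dots> = (\<integral>z. (3 / 4 * \<rho>\<^sup>2) ^ n * indicator (ball (0::'a) (\<rho> / 2)) z \<partial>lborel)"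
      by simp
    also have "\<dots> \<le> I"
      unfolding I_def
    proof (rule integral_mono[OF _ Gi])
      show "integrable lborel (\<lambda>z. (3 / 4 * \<rho>\<^sup>2) ^ n * indicator (ball (0::'a) (\<rho> / 2)) z)"
        by (auto intro!: emeasure_bounded_finite)
      fix z :: 'a
      show "(3 / 4 * \<rho>\<^sup>2) ^ n * indicator (ball 0 (\<rho> / 2)) z \<le> G 0 z"
      proof (cases "z \<in> ball 0 (\<rho> / 2)")
        case True
        then have "(norm z)\<^sup>2 \<le> (\<rho> / 2)\<^sup>2" by (intro power_mono) auto
        then have "3 / 4 * \<rho>\<^sup>2 \<le> \<rho>\<^sup>2 - (norm z)\<^sup>2" by (simp add: power_divide)
        then have "3 / 4 * \<rho>\<^sup>2 \<le> max 0 (\<rho>\<^sup>2 - (norm z)\<^sup>2)" by linarith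
        then have "(3 / 4 * \<rho>\<^sup>2) ^ n \<le> (max 0 (\<rho>\<^sup>2 - (norm z)\<^sup>2)) ^ n"
          by (intro power_mono) auto
        then show ?thesis using True by (simp add: G_def bump_def)
      qed (simp add: G0)
    qed
    finally show ?thesis .
  qed
  obtain a where "\<forall>x\<in>S. norm x \<le> a"
    using compact_imp_bounded[OF S(1)] unfolding bounded_iff by auto
  then have gi: "integrable lborel g"
    by (intro integrable_continuous_bounded_support[OF g, of 0 a] supp) auto
  define h where "h x = 1 / I * (\<integral>z. G x z * g z \<partial>lborel)" for x
  have "approximable \<Omega> S G h"
    unfolding h_def
    by (intro approximable_cmult approximable_integral[OF \<Omega> S(1) Gc gi supp])
  then have "approximable \<Omega> \<Omega> ?F h"
  proof (rule approximable_trans)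
    fix z assume "z \<in> S"
    then have "cball z \<rho> \<subseteq> \<Omega>"
      using \<rho>1(2) \<rho>(2) interior_subset by fastforce
    from approximable_bump[OF d \<Omega> \<rho>(1) this]
    show "approximable \<Omega> \<Omega> ?F (\<lambda>x. G x z)" unfolding G_def n_def .
  qed
  moreover have "\<bar>g x - h x\<bar> \<le> e" if x: "x \<in> \<Omega>" for x
  proof -
    have Ggi: "integrable lborel (\<lambda>z. G x z * g z)"
      by (rule integrable_continuous_bounded_support[of _ x \<rho>])
        (auto intro!: continuous_intros Gcx g Gsupp simp: dist_norm norm_minus_commute)
    have "(\<integral>z. G x z * g z \<partial>lborel) - I * g x = (\<integral>z. G x z * g z - G x z * g x \<partial>lborel)"
      using Ggi Gi I[of x] by simp
    also have "norm \<dots> \<le> (\<integral>z. G x z * e \<partial>lborel)"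
    proof (rule Bochner_Integration.integral_norm_bound_integral)
      fix z
      show "norm (G x z * g z - G x z * g x) \<le> G x z * e"
      proof (cases "norm (z - x) \<le> \<rho>")
        case True
        have "norm (G x z * g z - G x z * g x) = G x z * \<bar>g z - g x\<bar>"
          by (simp add: right_diff_distrib[symmetric] abs_mult G0)
        then show ?thesis using near[OF x True] G0 by (simp add: mult_left_mono)
      qed (simp add: Gsupp)
    qed (use Ggi Gi in auto)
    also have "\<dots> = I * e" by (simp add: I)
    finally have "\<bar>(\<integral>z. G x z * g z \<partial>lborel) - I * g x\<bar> \<le> I * e" by simp
    moreover have "(\<integral>z. G x z * g z \<partial>lborel) - I * g x = I * (h x - g x)"
      using \<open>I > 0\<close> by (simp add: h_def algebra_simps)
    ultimately have "I * \<bar>h x - g x\<bar> \<le> I * e" using \<open>I > 0\<close> by (simp add: abs_mult)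
    then show ?thesis using \<open>I > 0\<close> by (simp add: abs_minus_commute)
  qed
  ultimately show "\<exists>h. approximable \<Omega> \<Omega> ?F h \<and> (\<forall>x\<in>\<Omega>. \<bar>g x - h x\<bar> \<le> e)" by blast
qed

section \<open>Reduction to the boundary\<close>

text \<open>
  Reading the members of \<open>A\<close> as the sections of the evaluation kernel avoids having to choose for
  each restricted translate a centre that produces it.
\<close>

lemma fundamental_imp_approximable:
  assumes K: "compact K" and A: "fundamental_in_cont_funs K A" and f: "continuous_on K f"
  shows "approximable K A (\<lambda>x g. g x) f"
  unfolding approximable_def
proof (intro allI impI)
  fix e :: real assume "e > 0"
  have "restrict f K \<in> cont_funs K"
    unfolding cont_funs_def by (intro CollectI conjI restrict_extensional continuous_on_eq[OF f]) auto
  then obtain Y a where Y: "finite Y" "Y \<subseteq> A"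
    and *: "uniform_norm K (\<lambda>x. restrict f K x - (\<Sum>g\<in>Y. a g * g x)) < e"
    using A \<open>e > 0\<close> unfolding fundamental_in_cont_funs_def by blast
  have "\<bar>f x - (\<Sum>g\<in>Y. a g * g x)\<bar> \<le> e" if "x \<in> K" for x
  proof -
    have Yc: "continuous_on K g" if "g \<in> Y" for g
      using that Y(2) A unfolding fundamental_in_cont_funs_def cont_funs_def by blast
    have "continuous_on K (\<lambda>x. \<bar>f x - (\<Sum>g\<in>Y. a g * g x)\<bar>)"
      by (intro continuous_intros f Yc)
    then have "continuous_on K (\<lambda>x. \<bar>restrict f K x - (\<Sum>g\<in>Y. a g * g x)\<bar>)"
      by (rule continuous_on_eq) auto
    then have bdd: "bdd_above ((\<lambda>x. \<bar>restrict f K x - (\<Sum>g\<in>Y. a g * g x)\<bar>) ` K)"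
      by (intro bounded_imp_bdd_above compact_imp_bounded compact_continuous_image K)
    have "K \<noteq> {}" using that by auto
    from cSUP_upper[OF that bdd]
    have "\<bar>restrict f K x - (\<Sum>g\<in>Y. a g * g x)\<bar> \<le> uniform_norm K (\<lambda>x. restrict f K x - (\<Sum>g\<in>Y. a g * g x))"
      unfolding uniform_norm_def if_not_P[OF \<open>K \<noteq> {}\<close>] .
    also have "\<dots> < e" by (rule *)
    finally show ?thesis using that by simp
  qed
  with Y show "\<exists>Y a. finite Y \<and> Y \<subseteq> A \<and> (\<forall>x\<in>K. \<bar>f x - (\<Sum>g\<in>Y. a g * g x)\<bar> \<le> e)"
    by blast
qed

text \<open>
  Plain truncation of small values would not be continuous; shrinking towards zero by \<open>\<eta>\<close> is.
\<close>

definition soft_threshold :: "real \<Rightarrow> real \<Rightarrow> real" where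
  "soft_threshold \<eta> t = max (t - \<eta>) 0 + min (t + \<eta>) 0"

lemma soft_threshold_eq_0: "\<bar>t\<bar> \<le> \<eta> \<Longrightarrow> soft_threshold \<eta> t = 0"
  by (simp add: soft_threshold_def)

lemma soft_threshold_close: "\<eta> \<ge> 0 \<Longrightarrow> \<bar>t - soft_threshold \<eta> t\<bar> \<le> \<eta>"
  by (simp add: soft_threshold_def)

lemma soft_threshold_continuous: "continuous_on S (soft_threshold \<eta>)"
  unfolding soft_threshold_def[abs_def] by (intro continuous_intros)

theorem theorem7:
  fixes \<Omega> :: "(real ^ 'n::finite) set"
    and k :: nat
    and f :: "real ^ 'n \<Rightarrow> real"
    and \<epsilon> :: real
  assumes "real k > real CARD('n) / 2"
    and "compact \<Omega>"
    and "fundamental_in_cont_funs (frontier \<Omega>)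
           (spline_translates (frontier \<Omega>) (polyharmonic_spline CARD('n) k))"
    and "continuous_on \<Omega> f"
    and "\<epsilon> > 0"
  shows "\<exists>Y \<alpha>. finite Y \<and> Y \<subseteq> \<Omega> \<and>
           (\<forall>x\<in>\<Omega>. \<bar>f x - (\<Sum>y\<in>Y. \<alpha> y * polyharmonic_spline CARD('n) k (norm (x - y)))\<bar> \<le> \<epsilon>)"
proof -
  define F where "F x y = polyharmonic_spline CARD('n) k (norm (x - y))" for x y :: "real ^ 'n"
  have d: "DIM(real ^ 'n) < 2 * k" using assms(1) by simp
  have F: "F = (\<lambda>x y. polyharmonic_spline DIM(real ^ 'n) k (norm (x - y)))"
    by (intro ext) (simp add: F_def)
  have Fc: "continuous_on S (\<lambda>x. F x y)" for S y
  proof -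
    have "continuous_on S (\<lambda>x. (x, y))" by (intro continuous_intros)
    then have "continuous_on S (\<lambda>x. case (x, y) of (x, y) \<Rightarrow> F x y)"
      unfolding F by (rule continuous_on_compose2[OF polyharmonic_kernel_continuous[OF d]]) auto
    then show ?thesis by simp
  qed
  have fr: "frontier \<Omega> \<subseteq> \<Omega>"
    using assms(2) by (simp add: compact_imp_closed frontier_subset_closed)
  have "compact (frontier \<Omega>)" using assms(2) by (rule compact_frontier)
  then have "approximable (frontier \<Omega>) (spline_translates (frontier \<Omega>) (polyharmonic_spline CARD('n) k))
      (\<lambda>x g. g x) f"
    using assms(3) continuous_on_subset[OF assms(4) fr] by (rule fundamental_imp_approximable)
  then have "approximable (frontier \<Omega>) (frontier \<Omega>) F f"
  proof (rule approximable_trans)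
    fix g assume "g \<in> spline_translates (frontier \<Omega>) (polyharmonic_spline CARD('n) k)"
    then obtain y where y: "y \<in> frontier \<Omega>" "g = restrict (\<lambda>x. F x y) (frontier \<Omega>)"
      unfolding spline_translates_def F_def by blast
    then have "approximable (frontier \<Omega>) (frontier \<Omega>) F (\<lambda>x. F x y)"
      using approximable_finite_sum[of "{y}" "frontier \<Omega>" "frontier \<Omega>" F "\<lambda>_. 1"] by simp
    then show "approximable (frontier \<Omega>) (frontier \<Omega>) F (\<lambda>x. g x)"
      by (rule approximable_cong) (simp add: y(2))
  qed
  note on_frontier = this
  have "\<epsilon> / 4 > 0" "\<epsilon> / 2 > 0" using assms(5) by auto
  \<comment> \<open>The bound \<open>\<epsilon>/4\<close> lies strictly below the threshold \<open>\<epsilon>/2\<close>, which keeps the support of the thresholded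
    remainder away from the boundary.\<close>
  obtain Y0 \<alpha>0 where Y0: "finite Y0" "Y0 \<subseteq> frontier \<Omega>"
    and s: "\<And>x. x \<in> frontier \<Omega> \<Longrightarrow> \<bar>f x - (\<Sum>y\<in>Y0. \<alpha>0 y * F x y)\<bar> \<le> \<epsilon> / 4"
    using approximableD[OF on_frontier \<open>\<epsilon> / 4 > 0\<close>] by metis
  define s where "s x = (\<Sum>y\<in>Y0. \<alpha>0 y * F x y)" for x
  have gc: "continuous_on \<Omega> (\<lambda>x. f x - s x)"
    unfolding s_def by (intro continuous_intros assms(4) Fc)
  define g where "g x = (if x \<in> \<Omega> then soft_threshold (\<epsilon> / 2) (f x - s x) else 0)" for x
  define S where "S = {x \<in> \<Omega>. \<bar>f x - s x\<bar> \<ge> \<epsilon> / 2}"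
  have "closed S"
    unfolding S_def using assms(2)
    by (intro continuous_on_closed_Collect_le continuous_intros gc compact_imp_closed)
  then have "compact S"
    using assms(2) by (metis (no_types, lifting) S_def compact_Int_closed inf.absorb_iff2 mem_Collect_eq subsetI)
  have small: "\<bar>f x - s x\<bar> < \<epsilon> / 2" if "x \<in> frontier \<Omega>" for x
    using s[OF that] assms(5) unfolding s_def by linarith
  have "S \<subseteq> interior \<Omega>"
  proof
    fix x assume "x \<in> S"
    then have "x \<in> \<Omega>" "x \<notin> frontier \<Omega>" using small[of x] by (auto simp: S_def)
    then show "x \<in> interior \<Omega>"
      using closure_subset[of \<Omega>] by (auto simp: frontier_def)
  qed
  have cont: "continuous_on UNIV g"
  proof -
    have "continuous_on (\<Omega> \<union> closure (- \<Omega>)) g"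
      unfolding g_def
    proof (rule continuous_on_cases)
      show "continuous_on \<Omega> (\<lambda>x. soft_threshold (\<epsilon> / 2) (f x - s x))"
        by (rule continuous_on_compose2[OF soft_threshold_continuous gc]) auto
      show "\<forall>x. x \<in> \<Omega> \<and> x \<notin> \<Omega> \<or> x \<in> closure (- \<Omega>) \<and> x \<in> \<Omega> \<longrightarrow>
          soft_threshold (\<epsilon> / 2) (f x - s x) = 0"
      proof (intro allI impI)
        fix x assume "x \<in> \<Omega> \<and> x \<notin> \<Omega> \<or> x \<in> closure (- \<Omega>) \<and> x \<in> \<Omega>"
        then have "x \<in> frontier \<Omega>"
          using closure_subset[of \<Omega>] by (auto simp: frontier_closures)
        then show "soft_threshold (\<epsilon> / 2) (f x - s x) = 0"
          using small[of x] by (simp add: soft_threshold_eq_0)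
      qed
    qed (use assms(2) in \<open>auto simp: compact_imp_closed\<close>)
    moreover have "\<Omega> \<union> closure (- \<Omega>) = UNIV" using closure_subset[of "- \<Omega>"] by auto
    ultimately show ?thesis by simp
  qed
  have "g x = 0" if "x \<notin> S" for x
    using that by (auto simp: g_def S_def soft_threshold_eq_0)
  from approximable_compact_support[OF d assms(2) \<open>compact S\<close> \<open>S \<subseteq> interior \<Omega>\<close> cont this]
  have "approximable \<Omega> \<Omega> F g" unfolding F .
  moreover have "approximable \<Omega> \<Omega> F s"
    unfolding s_def using Y0 fr by (intro approximable_finite_sum) auto
  ultimately have sum: "approximable \<Omega> \<Omega> F (\<lambda>x. g x + s x)" by (rule approximable_add)
  obtain Y \<alpha> where Y: "finite Y" "Y \<subseteq> \<Omega>"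
    and close: "\<And>x. x \<in> \<Omega> \<Longrightarrow> \<bar>g x + s x - (\<Sum>y\<in>Y. \<alpha> y * F x y)\<bar> \<le> \<epsilon> / 2"
    using approximableD[OF sum \<open>\<epsilon> / 2 > 0\<close>] by metis
  have "\<forall>x\<in>\<Omega>. \<bar>f x - (\<Sum>y\<in>Y. \<alpha> y * F x y)\<bar> \<le> \<epsilon>"
  proof
    fix x assume x: "x \<in> \<Omega>"
    have "\<bar>(f x - s x) - g x\<bar> \<le> \<epsilon> / 2"
      using soft_threshold_close[of "\<epsilon> / 2" "f x - s x"] assms(5) x by (simp add: g_def)
    then show "\<bar>f x - (\<Sum>y\<in>Y. \<alpha> y * F x y)\<bar> \<le> \<epsilon>" using close[OF x] by linarith
  qed
  with Y show ?thesis
    unfolding F_def by (intro exI[of _ Y] exI[of _ \<alpha>] conjI)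
qed

end
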